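(* Let $m\ge n+1$, let $\xi$ be a solution of the $G^1_{m,n}$-system on an open set $\Omega \subset\mathbb R^{n+1}$ and $E$ a frame for $\xi$. Let $0\ne s\in\mathbb R$, let $W$ and $Z$ be unit vectors in $\mathbb R^m$ and $\mathbb R^{n,1}$ respectively (so $W^tW=1$, $Z^tJZ=1$), let $\pi$ be the projection onto $\mathbb C\begin{pmatrix}W\\ iZ\end{pmatrix}$ orthogonal with respect to $\langle\ ,\ \rangle_1$, and $q_{s,\pi}$ the associated rational map. Put $$\begin{pmatrix}\tilde W\\ i\tilde Z\end{pmatrix}(x)=E(x,-is)^{-1}\begin{pmatrix}W\\ iZ\end{pmatrix},$$ assume $\tilde W$ is nowhere zero on $\Omega$, and let $\tilde\pi(x)$ be the orthogonal projection onto the span of $\begin{pmatrix}\tilde W\\ i\tilde Z\end{pmatrix}(x)$ with respect to $\langle\ ,\ \rangle_1$. Set $$\tilde\xi=\xi-2s(\hat W\hat Z^tJ)_*,\qquad \tilde E(x,\lambda)=E(x,\lambda)\,q_{s,\tilde\pi(x)}^{-1}(\lambda),$$ where $\hat W=\tilde W/\|\tilde W\|_m$, $\hat Z=\tilde Z/\|\tilde Z\|_{n,1}$, and $(y_* )_{ij}=y_{ij}$ for $i\ne j$, $(y_* )_{ii}=0$. Then: (i) $\tilde\xi$ is a new solution of the $G^1_{m,n}$-system; (ii) $\tilde E$ is a frame for $\tilde\xi$; (iii) $E(x,0)=\begin{pmatrix}A(x)&0\\ 0&B(x)\end{pmatrix}$ and $\tilde E(x,0)=\begin{pmatrix}\tilde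 A(x)&0\\ 0&\tilde B(x)\end{pmatrix}$ for some $A,B,\tilde A,\tilde B$, and $$\tilde A=A(I-2\hat W\hat W^t),\qquad \tilde B=B(I-2\hat Z\hat Z^tJ).$$
   Context: $J=I_{n,1}=\mathrm{diag}(1,\dots,1,-1)$ (size $n+1$), $I_{m+n,1}=\mathrm{diag}(I_{m+n},-1)$, $I_{m,n+1}=\mathrm{diag}(I_m,-I_{n+1})$. $\mathbb R^{n,1}$ is $\mathbb R^{n+1}$ with the form $Z^tJZ$, $\|Z\|_{n,1}=\sqrt{Z^tJZ}$; $\|\cdot\|_m$ is the Euclidean norm. On $\mathbb C^{n+m+1}$, $\langle u,v\rangle_1=\sum_{i=1}^{n+m}\bar u_iv_i-\bar u_{n+m+1}v_{n+m+1}$. Concretely $\pi=\frac12\begin{pmatrix}WW^t&-iWZ^t\\ iZW^t&ZZ^t\end{pmatrix}I_{n+m,1}$, and $$q_{s,\pi}(\lambda)=\Big(\pi+\tfrac{\lambda-is}{\lambda+is}(I-\pi)\Big)\Big(\bar\pi+\tfrac{\lambda+is}{\lambda-is}(I-\bar\pi)\Big);$$ $\tilde\pi$ and $q_{s,\tilde\pi}$ are given by the same formulas with $W,Z$ replaced by $\hat W,\hat Z$. ($\tilde W,\tilde Z$ are real and $\|\tilde W\|_m^2=\tilde Z^tJ\tilde Z$.) $G^1_{m,n}$-system: $D_i$ is the real $m\times(n+1)$ matrix with single entry $1$ at $(i,i)$. A map $\xi=(\xi_{ij})$ with values in real $m\times(n+1)$ matrices, $\xi_{ii}=0$ for $1\le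 i\le n+1$, is a solution if $$\theta_\lambda=\sum_{i=1}^{n+1}\left\{\lambda\begin{pmatrix}0&-D_iJ\\ D_i^t&0\end{pmatrix}+\begin{pmatrix}D_i\xi^t-\xi D_i^t&0\\ 0&-J\xi^tD_iJ+D_i^t\xi\end{pmatrix}\right\}dx_i$$ is flat ($d\theta_\lambda+\theta_\lambda\wedge\theta_\lambda=0$) for all $\lambda\in\mathbb C$. A frame $E$ of a solution is a trivialization $E^{-1}dE=\theta_\lambda$ satisfying the $G^1_{m,n}$-reality condition: $\overline{E(x,\bar\lambda)}=E(x,\lambda)$, $I_{m,n+1}E(x,\lambda)I_{m,n+1}=E(x,-\lambda)$, $E(x,\lambda)^tI_{n+m,1}E(x,\lambda)=I_{n+m,1}$. The given frame $E$ is holomorphic in $\lambda\in\mathbb C$; the frame $\tilde E$ is defined for $\lambda\ne\pm is$. *)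

theory Defs
  imports "HOL-Analysis.Analysis"
begin

subsection \<open>Smooth maps and matrix-valued one-forms\<close>

text \<open>On a finite-dimensional space it suffices to differentiate in each fixed direction
  \<open>v\<close>; \<open>S\<close> is meant to be open.\<close>

primrec Ck_on :: "nat \<Rightarrow> ('a::real_normed_vector \<Rightarrow> 'b::real_normed_vector) \<Rightarrow> 'a set \<Rightarrow> bool" where
  "Ck_on 0 f S \<longleftrightarrow> continuous_on S f"
| "Ck_on (Suc k) f S \<longleftrightarrow> (\<forall>x\<in>S. f differentiable at x) \<and>
     (\<forall>v. Ck_on k (\<lambda>x. frechet_derivative f (at x) v) S)"

definition smooth_on :: "'a set \<Rightarrow> ('a::real_normed_vector \<Rightarrow> 'b::real_normed_vector) \<Rightarrow> bool" where
  "smooth_on S f \<longleftrightarrow> (\<forall>k. Ck_on k f S)"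

text \<open>A matrix-valued one-form is a function \<open>\<theta> x v\<close>, linear in the tangent vector \<open>v\<close>.\<close>

definition ext_deriv ::
  "('a::real_normed_vector \<Rightarrow> 'a \<Rightarrow> 'b::real_normed_vector) \<Rightarrow> 'a \<Rightarrow> 'a \<Rightarrow> 'a \<Rightarrow> 'b" where
  "ext_deriv \<theta> x u v =
     frechet_derivative (\<lambda>y. \<theta> y v) (at x) u - frechet_derivative (\<lambda>y. \<theta> y u) (at x) v"

definition wedge :: "('a \<Rightarrow> 'a \<Rightarrow> complex^'c^'c) \<Rightarrow> ('a \<Rightarrow> 'a \<Rightarrow> complex^'c^'c) \<Rightarrow>
    'a \<Rightarrow> 'a \<Rightarrow> 'a \<Rightarrow> complex^'c^'c" where
  "wedge \<theta> \<eta> x u v = \<theta> x u ** \<eta> x v - \<theta> x v ** \<eta> x u"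

definition flat_on ::
  "'a set \<Rightarrow> ('a::real_normed_vector \<Rightarrow> 'a \<Rightarrow> complex^'c^'c) \<Rightarrow> bool" where
  "flat_on S \<theta> \<longleftrightarrow> (\<forall>x\<in>S. \<forall>u v. ext_deriv \<theta> x u v + wedge \<theta> \<theta> x u v = 0)"

subsection \<open>Matrices and the indefinite forms\<close>

text \<open>\<open>'m\<close> indexes \<open>\<real>\<^sup>m\<close> and \<open>'k\<close> indexes \<open>\<real>\<^sup>n\<^sup>+\<^sup>1\<close>, so that \<open>'m + 'k\<close>
  indexes matrices of size \<open>m + n + 1\<close>. Both index types are linearly ordered: \<open>pos i\<close> is the
  (zero-based) place of \<open>i\<close>, which identifies the first \<open>n + 1\<close> rows with the columns of an
  \<open>m \<times> (n + 1)\<close> matrix, and the last element of \<open>'k\<close> is the timelike direction.\<close>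

type_synonym 'i rvec = "(real, 'i) vec"
type_synonym ('r, 'c) rmat = "((real, 'c) vec, 'r) vec"
type_synonym ('m, 'k) cvec = "(complex, 'm + 'k) vec"
type_synonym ('m, 'k) cblock = "((complex, 'm + 'k) vec, 'm + 'k) vec"

definition pos :: "'i::{finite,linorder} \<Rightarrow> nat" where
  "pos i = card {j. j < i}"

definition last_index :: "'k::{finite,linorder}" where
  "last_index = Max UNIV"

definition J_mat :: "'a::ring_1^'k::{finite,linorder}^'k::{finite,linorder}" where
  "J_mat = (\<chi> i j. if i \<noteq> j then 0 else if i = last_index then -1 else 1)"

definition norm_n1 :: "'k::{finite,linorder} rvec \<Rightarrow> real" where
  "norm_n1 z = sqrt (z \<bullet> (J_mat *v z))"

definition outer :: "real^'r \<Rightarrow> real^'c \<Rightarrow> real^'c^'r" where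
  "outer w z = (\<chi> a b. w $ a * z $ b)"

definition block :: "'a^'m^'m \<Rightarrow> 'a^'k^'m \<Rightarrow> 'a^'m^'k \<Rightarrow> 'a^'k^'k \<Rightarrow> 'a^('m + 'k)^('m + 'k)" where
  "block P Q R S = (\<chi> i j. case i of
      Inl a \<Rightarrow> (case j of Inl b \<Rightarrow> P $ a $ b | Inr b \<Rightarrow> Q $ a $ b)
    | Inr a \<Rightarrow> (case j of Inl b \<Rightarrow> R $ a $ b | Inr b \<Rightarrow> S $ a $ b))"

definition I_nm_1 :: "('m::finite, 'k::{finite,linorder}) cblock" where
  "I_nm_1 = block (mat 1) 0 0 J_mat"

definition I_m_n1 :: "('m::finite, 'k::finite) cblock" where
  "I_m_n1 = block (mat 1) 0 0 (- mat 1)"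

definition cmat :: "real^'c^'r \<Rightarrow> complex^'c^'r" where
  "cmat = map_matrix complex_of_real"

definition conj_mat :: "complex^'c^'r \<Rightarrow> complex^'c^'r" where
  "conj_mat = map_matrix cnj"

definition cscale :: "complex \<Rightarrow> complex^'c^'r \<Rightarrow> complex^'c^'r" where
  "cscale c = map_matrix ((*) c)"

text \<open>The column vector with upper part \<open>w\<close> and lower part \<open>i z\<close>.\<close>

definition lift_vec :: "real^'m \<Rightarrow> real^'k \<Rightarrow> complex^('m + 'k)" where
  "lift_vec w z = (\<chi> i. case i of Inl a \<Rightarrow> complex_of_real (w $ a)
                                | Inr b \<Rightarrow> \<i> * complex_of_real (z $ b))"

definition herm1 :: "('m::finite, 'k::{finite,linorder}) cvec \<Rightarrow> ('m, 'k) cvec \<Rightarrow> complex" where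
  "herm1 u v = (\<Sum>i\<in>UNIV - {Inr last_index}. cnj (u $ i) * v $ i)
             - cnj (u $ Inr last_index) * v $ Inr last_index"

definition is_orth_proj1 :: "('m::finite, 'k::{finite,linorder}) cvec set \<Rightarrow>
    ('m, 'k) cblock \<Rightarrow> bool" where
  "is_orth_proj1 V P \<longleftrightarrow> (\<forall>v. P *v v \<in> V \<and> (\<forall>w\<in>V. herm1 w (v - P *v v) = 0))"

subsection \<open>The system, its frames and the simple rational elements\<close>

text \<open>The spectral parameter (usually lambda) is written \<open>\<mu>\<close>.\<close>

definition D_mat :: "'k::{finite,linorder} \<Rightarrow> ('m::{finite,linorder}, 'k) rmat" where
  "D_mat i = (\<chi> a b. if pos a = pos i \<and> b = i then 1 else 0)"

definition off_diag :: "('m::{finite,linorder}, 'k::{finite,linorder}) rmat \<Rightarrow> ('m, 'k) rmat" where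
  "off_diag y = (\<chi> a b. if pos a = pos b then 0 else y $ a $ b)"

definition theta :: "('k::{finite,linorder} rvec \<Rightarrow> ('m::{finite,linorder}, 'k) rmat) \<Rightarrow> complex \<Rightarrow>
    'k rvec \<Rightarrow> 'k rvec \<Rightarrow> ('m, 'k) cblock" where
  "theta \<xi> \<mu> x v = (\<Sum>i\<in>UNIV. v $ i *\<^sub>R
     (cscale \<mu> (cmat (block 0 (- (D_mat i ** J_mat)) (transpose (D_mat i)) 0))
      + cmat (block (D_mat i ** transpose (\<xi> x) - \<xi> x ** transpose (D_mat i)) 0
                    0 (transpose (D_mat i) ** \<xi> x - J_mat ** transpose (\<xi> x) ** D_mat i ** J_mat))))"

definition G1_solution :: "'k::{finite,linorder} rvec set \<Rightarrow>
    ('k rvec \<Rightarrow> ('m::{finite,linorder}, 'k) rmat) \<Rightarrow> bool" where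
  "G1_solution \<Omega> \<xi> \<longleftrightarrow> smooth_on \<Omega> \<xi> \<and>
     (\<forall>x\<in>\<Omega>. \<forall>a b. pos a = pos b \<longrightarrow> \<xi> x $ a $ b = 0) \<and>
     (\<forall>\<mu>. flat_on \<Omega> (theta \<xi> \<mu>))"

text \<open>\<open>\<Lambda>\<close> is the set of spectral parameters for which the frame is defined.\<close>

definition G1_frame :: "'k::{finite,linorder} rvec set \<Rightarrow> complex set \<Rightarrow>
    ('k rvec \<Rightarrow> ('m::{finite,linorder}, 'k) rmat) \<Rightarrow>
    ('k rvec \<Rightarrow> complex \<Rightarrow> ('m, 'k) cblock) \<Rightarrow> bool" where
  "G1_frame \<Omega> \<Lambda> \<xi> E \<longleftrightarrow>
     (\<forall>\<mu>\<in>\<Lambda>. smooth_on \<Omega> (\<lambda>x. E x \<mu>)) \<and>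
     (\<forall>x\<in>\<Omega>. \<forall>i j. (\<lambda>\<mu>. E x \<mu> $ i $ j) holomorphic_on \<Lambda>) \<and>
     (\<forall>x\<in>\<Omega>. \<forall>\<mu>\<in>\<Lambda>. invertible (E x \<mu>) \<and>
        (\<forall>v. matrix_inv (E x \<mu>) ** frechet_derivative (\<lambda>y. E y \<mu>) (at x) v = theta \<xi> \<mu> x v) \<and>
        conj_mat (E x (cnj \<mu>)) = E x \<mu> \<and>
        I_m_n1 ** E x \<mu> ** I_m_n1 = E x (- \<mu>) \<and>
        transpose (E x \<mu>) ** I_nm_1 ** E x \<mu> = I_nm_1)"

definition q_map :: "real \<Rightarrow> complex^'c^'c \<Rightarrow> complex \<Rightarrow> complex^'c^'c" where
  "q_map s P \<mu> =
     (P + cscale ((\<mu> - \<i> * of_real s) / (\<mu> + \<i> * of_real s)) (mat 1 - P)) **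
     (conj_mat P + cscale ((\<mu> + \<i> * of_real s) / (\<mu> - \<i> * of_real s)) (mat 1 - conj_mat P))"

subsection \<open>The lifted vectors stay real, and the projections in closed form\<close>

lemma block_sum_univ:
  fixes f :: "'m::finite + 'k::finite \<Rightarrow> 'a::comm_monoid_add"
  shows "(\<Sum>i\<in>UNIV. f i) = (\<Sum>a\<in>UNIV. f (Inl a)) + (\<Sum>b\<in>UNIV. f (Inr b))"
proof -
  have "(\<Sum>i\<in>UNIV. f i) = (\<Sum>i\<in>UNIV <+> UNIV. f i)"
    by simp
  also have "\<dots> = (\<Sum>a\<in>UNIV. f (Inl a)) + (\<Sum>b\<in>UNIV. f (Inr b))"
    by (subst sum.Plus) auto
  finally show ?thesis .
qed

lemma I_m_n1_vec:
  "(I_m_n1 *v v) $ Inl a = v $ Inl a" "(I_m_n1 *v v) $ Inr b = - v $ Inr b"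
  by (auto simp: I_m_n1_def block_def matrix_vector_mult_def block_sum_univ mat_def
      if_distrib [of "\<lambda>x. x * _"] if_distrib [of uminus] sum_negf cong: if_cong)

lemma I_m_n1_square: "I_m_n1 ** I_m_n1 = mat 1"
proof (rule matrix_eq [THEN iffD2], rule allI)
  fix v :: "complex^('a + 'b)"
  show "(I_m_n1 ** I_m_n1) *v v = mat 1 *v v"
    unfolding matrix_vector_mul_assoc [symmetric] matrix_vector_mul_lid vec_eq_iff
  proof
    fix i show "(I_m_n1 *v (I_m_n1 *v v)) $ i = v $ i"
      by (cases i) (auto simp: I_m_n1_vec)
  qed
qed

lemma conj_mat_vec: "(conj_mat A *v (\<chi> i. cnj (u $ i))) = (\<chi> i. cnj ((A *v u) $ i))"
  by (simp add: conj_mat_def matrix_vector_mult_def vec_eq_iff)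

lemma matrix_inv_mult:
  fixes A :: "complex^'c^'c"
  assumes "invertible A"
  shows "matrix_inv A ** A = mat 1" "A ** matrix_inv A = mat 1"
  using assms unfolding invertible_def matrix_inv_def by (metis (mono_tags, lifting) someI_ex)+

lemma lift_vec_real_exists:
  fixes E :: "'k::{finite,linorder} rvec \<Rightarrow> complex \<Rightarrow> ('m::{finite,linorder}, 'k) cblock"
  assumes "G1_frame \<Omega> UNIV \<xi> E" "x \<in> \<Omega>"
  shows "\<exists>w z. lift_vec w z = matrix_inv (E x (- \<i> * of_real s)) *v lift_vec W Z"
proof -
  define M where "M = E x (- \<i> * of_real s)"
  define u where "u = matrix_inv M *v lift_vec W Z"
  define K where "K = (I_m_n1 :: ('m, 'k) cblock)"
  define cu where "cu = (\<chi> i. cnj (u $ i))"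
  have F: "invertible (E x \<mu>)" "conj_mat (E x (cnj \<mu>)) = E x \<mu>"
    "I_m_n1 ** E x \<mu> ** I_m_n1 = E x (- \<mu>)" for \<mu>
    using assms by (simp_all add: G1_frame_def)
  have inv: "invertible M"
    by (simp add: M_def F)
  have c: "conj_mat M = E x (\<i> * of_real s)"
    using F(2) [of "\<i> * of_real s"] by (simp add: M_def)
  have r: "K ** M ** K = E x (\<i> * of_real s)"
    using F(3) [of "- \<i> * of_real s"] by (simp add: M_def K_def)
  have Mu: "M *v u = lift_vec W Z"
    using matrix_inv_mult [OF inv] by (simp add: u_def matrix_vector_mul_assoc)
  have KK: "K *v (K *v v) = v" for v
    by (simp add: K_def matrix_vector_mul_assoc I_m_n1_square)
  have cL: "(\<chi> i. cnj (lift_vec W Z $ i)) = K *v lift_vec W Z"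
  proof -
    have "cnj (lift_vec W Z $ i) = (K *v lift_vec W Z) $ i" for i
      by (cases i) (auto simp: K_def I_m_n1_vec lift_vec_def)
    then show ?thesis by (simp add: vec_eq_iff)
  qed
  have "K *v (M *v (K *v cu)) = conj_mat M *v cu"
    using c r by (metis matrix_vector_mul_assoc)
  also have "\<dots> = K *v lift_vec W Z"
    unfolding cu_def conj_mat_vec Mu cL ..
  finally have "M *v (K *v cu) = lift_vec W Z"
    by (metis KK)
  then have Ku: "K *v cu = u"
    by (metis Mu matrix_inv_mult(1) [OF inv] matrix_vector_mul_assoc matrix_vector_mul_lid)
  have top: "cnj (u $ Inl a) = u $ Inl a" and bot: "cnj (u $ Inr b) = - (u $ Inr b)" for a b
    using arg_cong [OF Ku, of "\<lambda>v. v $ Inl a"] arg_cong [OF Ku, of "\<lambda>v. v $ Inr b"]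
    by (auto simp: K_def I_m_n1_vec cu_def) (metis minus_minus)
  have "lift_vec (\<chi> a. Re (u $ Inl a)) (\<chi> b. Im (u $ Inr b)) $ i = u $ i" for i
  proof (cases i)
    case (Inl a)
    then show ?thesis using top [of a] by (auto simp: lift_vec_def complex_eq_iff)
  next
    case (Inr b)
    then show ?thesis using bot [of b] by (auto simp: lift_vec_def complex_eq_iff)
  qed
  then show ?thesis
    unfolding u_def M_def by (metis vec_eq_iff)
qed

lemma herm1_alt:
  fixes u :: "('m::finite, 'k::{finite,linorder}) cvec"
  shows "herm1 u v = (\<Sum>a\<in>UNIV. cnj (u $ Inl a) * v $ Inl a) +
     (\<Sum>b\<in>UNIV. cnj (u $ Inr b) * (J_mat *v (\<chi> b. v $ Inr b)) $ b)"
proof -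
  have J: "(J_mat *v y) $ b = (if b = last_index then - y $ b else y $ b)" for y :: "(complex, 'k) vec" and b
  proof -
    have "(J_mat *v y) $ b
        = (\<Sum>j\<in>UNIV. if b = j then (if b = last_index then - y $ b else y $ b) else 0)"
      unfolding matrix_vector_mult_def J_mat_def vec_lambda_beta by (intro sum.cong refl) auto
    then show ?thesis by simp
  qed
  define g where "g = (\<lambda>b. cnj (u $ Inr b) * v $ Inr b)"
  have A: "(\<Sum>b\<in>UNIV. cnj (u $ Inr b) * (J_mat *v (\<chi> b. v $ Inr b)) $ b)
      = (\<Sum>b\<in>UNIV - {last_index}. g b) - g last_index"
    by (subst sum.remove [of UNIV last_index]) (auto simp: J g_def intro!: sum.cong)
  have "(\<Sum>i\<in>UNIV - {Inr last_index}. cnj (u $ i) * v $ i)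
      = (\<Sum>i\<in>UNIV. cnj (u $ i) * v $ i) - g last_index"
    by (subst sum_diff) (auto simp: g_def)
  also have "\<dots> = (\<Sum>a\<in>UNIV. cnj (u $ Inl a) * v $ Inl a) + (\<Sum>b\<in>UNIV - {last_index}. g b)"
    using sum.remove [of UNIV last_index g] by (simp add: block_sum_univ g_def)
  finally show ?thesis
    unfolding herm1_def A by (simp add: g_def)
qed

lemma herm1_linear:
  "herm1 u (v - w) = herm1 u v - herm1 u w" "herm1 u (c *s v) = c * herm1 u v"
  "herm1 (c *s u) v = cnj c * herm1 u v"
  by (auto simp: herm1_def algebra_simps sum_subtractf sum_distrib_left)

lemma is_orth_proj1_span:
  assumes "herm1 u u \<noteq> 0"
  shows "is_orth_proj1 (vec.span {u}) P \<longleftrightarrow> (\<forall>v. P *v v = (herm1 u v / herm1 u u) *s u)"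
proof
  assume P: "is_orth_proj1 (vec.span {u}) P"
  show "\<forall>v. P *v v = (herm1 u v / herm1 u u) *s u"
  proof
    fix v
    have "P *v v \<in> vec.span {u}" and o: "herm1 u (v - P *v v) = 0"
      using P vec.span_base [of u "{u}"] by (auto simp: is_orth_proj1_def)
    then obtain c where c: "P *v v = c *s u"
      by (auto simp: vec.span_singleton)
    then have "herm1 u v = c * herm1 u u"
      using o by (simp add: herm1_linear)
    then show "P *v v = (herm1 u v / herm1 u u) *s u"
      using assms c by simp
  qed
next
  assume P: "\<forall>v. P *v v = (herm1 u v / herm1 u u) *s u"
  then show "is_orth_proj1 (vec.span {u}) P"
    using assms by (auto simp: is_orth_proj1_def vec.span_singleton herm1_linear)
qed

lemma J_mat_cvec:
  "(J_mat *v (\<chi> b. \<i> * complex_of_real (z $ b))) $ b = \<i> * complex_of_real ((J_mat *v z) $ b)"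
  by (auto simp: J_mat_def matrix_vector_mult_def sum_distrib_left intro!: sum.cong)

lemma herm1_lift_vec:
  "herm1 (lift_vec w z) (lift_vec w z) = of_real (w \<bullet> w + z \<bullet> (J_mat *v z))"
  by (simp add: herm1_alt J_mat_cvec lift_vec_def inner_vec_def algebra_simps sum_distrib_left)

lemma orth_proj1_closed_form:
  fixes w :: "'m::{finite,linorder} rvec" and z :: "'k::{finite,linorder} rvec"
  assumes "w \<bullet> w = 1" "z \<bullet> (J_mat *v z) = 1"
  shows "is_orth_proj1 (vec.span {lift_vec w z}) P \<longleftrightarrow>
    P = cscale (1 / 2) (block (cmat (outer w w))
                              (cscale (- \<i>) (cmat (outer w z)))
                              (cscale \<i> (cmat (outer z w)))
                              (cmat (outer z z))) ** I_nm_1"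
    (is "_ \<longleftrightarrow> P = ?Q")
proof -
  define u where "u = lift_vec w z"
  have u2: "herm1 u u = 2"
    using assms by (simp add: u_def herm1_lift_vec)
  have I1: "(I_nm_1 *v v) $ Inl a = v $ Inl a"
    and I2: "(I_nm_1 *v v) $ Inr b = (J_mat *v (\<chi> b. v $ Inr b)) $ b"
    for v :: "('m, 'k) cvec" and a b
    by (auto simp: I_nm_1_def block_def matrix_vector_mult_def block_sum_univ mat_def
        if_distrib [of "\<lambda>x. x * _"] cong: if_cong)
  have "?Q *v v = (herm1 u v / herm1 u u) *s u" for v
  proof -
    define y where "y = J_mat *v (\<chi> b. v $ Inr b)"
    have h: "herm1 u v = (\<Sum>a\<in>UNIV. of_real (w $ a) * v $ Inl a)
        + (\<Sum>b\<in>UNIV. - \<i> * of_real (z $ b) * y $ b)"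
      unfolding herm1_alt y_def by (simp add: u_def lift_vec_def)
    have "(?Q *v v) $ i = ((herm1 u v / herm1 u u) *s u) $ i" for i
    proof -
      have I: "(I_nm_1 *v v) $ Inl a = v $ Inl a" "(I_nm_1 *v v) $ Inr b = y $ b" for a b
        by (simp_all add: I1 I2 y_def)
      have "(?Q *v v) $ i = (cscale (1 / 2) (block (cmat (outer w w))
          (cscale (- \<i>) (cmat (outer w z))) (cscale \<i> (cmat (outer z w))) (cmat (outer z z)))
          *v (I_nm_1 *v v)) $ i"
        by (simp add: matrix_vector_mul_assoc)
      also have "\<dots> = ((herm1 u v / 2) *s u) $ i"
        unfolding h matrix_vector_mult_def [of "cscale _ _"]
        by (cases i)
          (simp_all add: block_sum_univ I cscale_def block_def cmat_def outer_def u_def lift_vec_def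
            sum_distrib_left sum_distrib_right sum_divide_distrib sum_negf algebra_simps)
      finally show ?thesis unfolding u2 .
    qed
    then show ?thesis by (simp add: vec_eq_iff)
  qed
  then show ?thesis
    unfolding u_def [symmetric] using u2 is_orth_proj1_span [of u P]
    by (auto simp: matrix_eq)
qed

end

theory Submission
  imports Defs
begin

text \<open>Write the connection form as \<open>\<mu> a + [a, p(\<xi>)]\<close>, put \<open>c = \<i> s\<close>, and let
  \<open>P\<close> be the projection onto the line of the lifted vector \<open>u\<close> and \<open>Q\<close> its conjugate. Since
  \<open>u\<close> is parallel for the connection at \<open>\<mu> = - c\<close>, the projection solves the Riccati equation
  \<open>dP = P b - b P + c (P a + a P - 2 P a P)\<close> with \<open>b = [a, p(\<xi>)]\<close>. As \<open>u\<close> is isotropic for the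
  complex bilinear form, \<open>P\<close> and \<open>Q\<close> are orthogonal idempotents and \<open>Q a P = 0\<close>; with these
  relations the inverse simple element \<open>1 + e P + f Q\<close> gauges the connection to
  \<open>\<mu> a + b - 2 c [a, P - Q]\<close>, with no poles left. The block form of \<open>P - Q\<close> identifies this with the
  connection of the new potential. Away from \<open>\<mu> = \<plusminus> c\<close> flatness follows from the frame by the symmetry
  of second derivatives, and the curvature is a polynomial in \<open>\<mu>\<close>.\<close>

subsection \<open>Smooth maps and symmetry of second derivatives\<close>

lemma Ck_on_cong:
  assumes "open S" "\<And>x. x \<in> S \<Longrightarrow> f x = g x" "Ck_on k f S"
  shows "Ck_on k g S"
  using assms(2,3)
proof (induction k arbitrary: f g)
  case 0
  then show ?case
    by (simp cong: continuous_on_cong)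
next
  case (Suc k)
  have d: "f differentiable at x" if "x \<in> S" for x
    using Suc.prems that by simp
  have eq: "frechet_derivative f (at x) = frechet_derivative g (at x)" if "x \<in> S" for x
    using frechet_derivative_transform_within_open [OF d [OF that] assms(1) that] Suc.prems(1)
    by blast
  have "g differentiable at x" if "x \<in> S" for x
    using d [OF that] has_derivative_transform_within_open [OF _ assms(1) that] Suc.prems(1)
    unfolding differentiable_def by blast
  moreover have "Ck_on k (\<lambda>x. frechet_derivative g (at x) v) S" for v
  proof (rule Suc.IH)
    show "Ck_on k (\<lambda>x. frechet_derivative f (at x) v) S"
      using Suc.prems(2) by simp
  qed (simp add: eq)
  ultimately show ?case by simp
qed

lemma Ck_on_SucI:
  assumes "open S" "\<And>x. x \<in> S \<Longrightarrow> (f has_derivative f' x) (at x)"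
    "\<And>v. Ck_on k (\<lambda>x. f' x v) S"
  shows "Ck_on (Suc k) f S"
proof -
  have "frechet_derivative f (at x) = f' x" if "x \<in> S" for x
    using frechet_derivative_at [OF assms(2) [OF that]] by simp
  then have "Ck_on k (\<lambda>x. frechet_derivative f (at x) v) S" for v
    using Ck_on_cong [OF assms(1) _ assms(3) [of v]] by simp
  then show ?thesis
    using assms(2) by (auto simp: differentiable_def)
qed

lemma Ck_on_Suc_has_derivative:
  assumes "Ck_on (Suc k) f S" "x \<in> S"
  shows "(f has_derivative frechet_derivative f (at x)) (at x)"
  using assms by (simp add: frechet_derivative_works [symmetric])

lemma Ck_on_SucD: "Ck_on (Suc k) f S \<Longrightarrow> Ck_on k f S"
proof (induction k arbitrary: f)
  case 0
  then show ?case
    by (simp add: differentiable_imp_continuous_on differentiable_at_imp_differentiable_on)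
next
  case (Suc k)
  then show ?case
    by (metis Ck_on.simps(2))
qed

lemma Ck_on_const: "Ck_on k (\<lambda>x. c) S"
  by (induction k arbitrary: c) simp_all

lemma Ck_on_linear:
  assumes "bounded_linear L" "open S" "Ck_on k f S"
  shows "Ck_on k (\<lambda>x. L (f x)) S"
  using assms(3)
proof (induction k arbitrary: f)
  case 0
  then show ?case
    using assms(1) by (simp add: bounded_linear.continuous_on)
next
  case (Suc k)
  show ?case
  proof (rule Ck_on_SucI [OF assms(2)])
    show "((\<lambda>x. L (f x)) has_derivative (\<lambda>v. L (frechet_derivative f (at x) v))) (at x)"
      if "x \<in> S" for x
      using bounded_linear.has_derivative [OF assms(1)] Ck_on_Suc_has_derivative [OF Suc.prems that] .
    show "Ck_on k (\<lambda>x. L (frechet_derivative f (at x) v)) S" for v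
      using Suc.prems by (intro Suc.IH) simp
  qed
qed

lemma Ck_on_add:
  assumes "open S" "Ck_on k f S" "Ck_on k g S"
  shows "Ck_on k (\<lambda>x. f x + g x) S"
  using assms(2,3)
proof (induction k arbitrary: f g)
  case 0
  then show ?case
    by (simp add: continuous_on_add)
next
  case (Suc k)
  show ?case
  proof (rule Ck_on_SucI [OF assms(1)])
    show "((\<lambda>x. f x + g x) has_derivative
        (\<lambda>v. frechet_derivative f (at x) v + frechet_derivative g (at x) v)) (at x)"
      if "x \<in> S" for x
      using Ck_on_Suc_has_derivative Suc.prems that by (intro has_derivative_add) blast+
    show "Ck_on k (\<lambda>x. frechet_derivative f (at x) v + frechet_derivative g (at x) v) S" for v
      using Suc.prems by (intro Suc.IH) simp_all
  qed
qed

lemma Ck_on_bilinear: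
  assumes "bounded_bilinear B" "open S" "Ck_on k f S" "Ck_on k g S"
  shows "Ck_on k (\<lambda>x. B (f x) (g x)) S"
  using assms(3,4)
proof (induction k arbitrary: f g)
  case 0
  then show ?case
    using assms(1) by (simp add: bounded_bilinear.continuous_on)
next
  case (Suc k)
  show ?case
  proof (rule Ck_on_SucI [OF assms(2)])
    show "((\<lambda>x. B (f x) (g x)) has_derivative
        (\<lambda>v. B (f x) (frechet_derivative g (at x) v) + B (frechet_derivative f (at x) v) (g x))) (at x)"
      if "x \<in> S" for x
      by (rule bounded_bilinear.FDERIV [OF assms(1)])
        (use Suc.prems that in \<open>blast intro: Ck_on_Suc_has_derivative\<close>)+
    have "Ck_on k f S" "Ck_on k g S"
      using Suc.prems by (blast intro: Ck_on_SucD)+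
    then show "Ck_on k (\<lambda>x. B (f x) (frechet_derivative g (at x) v) +
        B (frechet_derivative f (at x) v) (g x)) S" for v
      using Suc.prems by (intro Ck_on_add [OF assms(2)] Suc.IH) simp_all
  qed
qed

lemma Ck_on_inverse:
  fixes f :: "'a::real_normed_vector \<Rightarrow> 'b::real_normed_field"
  assumes "open S" "\<And>x. x \<in> S \<Longrightarrow> f x \<noteq> 0" "Ck_on k f S"
  shows "Ck_on k (\<lambda>x. inverse (f x)) S"
  using assms(3)
proof (induction k)
  case 0
  then show ?case
    using assms(2) by (simp add: continuous_on_inverse)
next
  case (Suc k)
  note mult = Ck_on_bilinear [OF bounded_bilinear_mult assms(1)]
  have inv: "Ck_on k (\<lambda>x. inverse (f x)) S"
    using Suc Ck_on_SucD by blast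
  show ?case
  proof (rule Ck_on_SucI [OF assms(1)])
    show "((\<lambda>x. inverse (f x)) has_derivative
        (\<lambda>v. - (inverse (f x) * frechet_derivative f (at x) v * inverse (f x)))) (at x)"
      if "x \<in> S" for x
      using assms(2) [OF that] Ck_on_Suc_has_derivative [OF Suc.prems that]
      by (rule Deriv.has_derivative_inverse)
    show "Ck_on k (\<lambda>x. - (inverse (f x) * frechet_derivative f (at x) v * inverse (f x))) S" for v
      using Suc.prems
      by (intro Ck_on_linear [OF bounded_linear_minus [OF bounded_linear_ident] assms(1)] mult inv) simp
  qed
qed

lemma smooth_on_cong:
  assumes "open S" "\<And>x. x \<in> S \<Longrightarrow> f x = g x"
  shows "smooth_on S f \<longleftrightarrow> smooth_on S g"
  using Ck_on_cong [OF assms(1), of f g] Ck_on_cong [OF assms(1), of g f] assms(2)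
  unfolding smooth_on_def by metis

lemma smooth_on_has_derivative:
  assumes "smooth_on S f" "x \<in> S"
  shows "(f has_derivative frechet_derivative f (at x)) (at x)"
  using assms Ck_on_Suc_has_derivative unfolding smooth_on_def by blast

lemma smooth_on_const: "smooth_on S (\<lambda>x. c)"
  by (simp add: smooth_on_def Ck_on_const)

lemma smooth_on_linear:
  "\<lbrakk>bounded_linear L; open S; smooth_on S f\<rbrakk> \<Longrightarrow> smooth_on S (\<lambda>x. L (f x))"
  by (simp add: smooth_on_def Ck_on_linear)

lemma smooth_on_add:
  "\<lbrakk>open S; smooth_on S f; smooth_on S g\<rbrakk> \<Longrightarrow> smooth_on S (\<lambda>x. f x + g x)"
  by (simp add: smooth_on_def Ck_on_add)

lemma smooth_on_bilinear:
  "\<lbrakk>bounded_bilinear B; open S; smooth_on S f; smooth_on S g\<rbrakk> \<Longrightarrow> smooth_on S (\<lambda>x. B (f x) (g x))"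
  by (simp add: smooth_on_def Ck_on_bilinear)

lemma smooth_on_inverse:
  fixes f :: "'a::real_normed_vector \<Rightarrow> 'b::real_normed_field"
  shows "\<lbrakk>open S; \<And>x. x \<in> S \<Longrightarrow> f x \<noteq> 0; smooth_on S f\<rbrakk> \<Longrightarrow> smooth_on S (\<lambda>x. inverse (f x))"
  by (simp add: smooth_on_def Ck_on_inverse)

lemma second_difference_mean_value:
  fixes f :: "'a::real_normed_vector \<Rightarrow> real"
  assumes "Ck_on 2 f S" "0 < t"
    "\<And>a b. \<lbrakk>a \<in> {0..t}; b \<in> {0..t}\<rbrakk> \<Longrightarrow> x + a *\<^sub>R u + b *\<^sub>R v \<in> S"
  shows "\<exists>a\<in>{0..t}. \<exists>b\<in>{0..t}.
    f (x + t *\<^sub>R u + t *\<^sub>R v) - f (x + t *\<^sub>R u) - f (x + t *\<^sub>R v) + f x =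
    t\<^sup>2 * frechet_derivative (\<lambda>y. frechet_derivative f (at y) u) (at (x + a *\<^sub>R u + b *\<^sub>R v)) v"
proof -
  define g where "g y = frechet_derivative f (at y) u" for y
  have C: "Ck_on (Suc (Suc 0)) f S"
    using assms(1) by (simp only: numeral_2_eq_2)
  then have Cg: "Ck_on (Suc 0) g S"
    unfolding g_def by (subst (asm) Ck_on.simps(2)) blast
  note f' = Ck_on_Suc_has_derivative [OF C] and g' = Ck_on_Suc_has_derivative [OF Cg]
  have df: "((\<lambda>a. f (x + a *\<^sub>R u + b *\<^sub>R v)) has_real_derivative g (x + a *\<^sub>R u + b *\<^sub>R v)) (at a)"
    if "a \<in> {0..t}" "b \<in> {0..t}" for a b
  proof -
    have "((\<lambda>a. x + a *\<^sub>R u + b *\<^sub>R v) has_derivative (\<lambda>h. h *\<^sub>R u)) (at a)"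
      by (auto intro!: derivative_eq_intros)
    from has_derivative_compose [OF this f' [OF assms(3) [OF that]]]
    have "((\<lambda>a. f (x + a *\<^sub>R u + b *\<^sub>R v)) has_derivative
        (\<lambda>h. frechet_derivative f (at (x + a *\<^sub>R u + b *\<^sub>R v)) (h *\<^sub>R u))) (at a)" .
    then show ?thesis
      using linear_scale [OF has_derivative_linear [OF f' [OF assms(3) [OF that]]]]
      by (simp add: g_def has_field_derivative_def mult_commute_abs)
  qed
  have dg: "((\<lambda>b. g (x + a *\<^sub>R u + b *\<^sub>R v)) has_real_derivative
      frechet_derivative g (at (x + a *\<^sub>R u + b *\<^sub>R v)) v) (at b)"
    if "a \<in> {0..t}" "b \<in> {0..t}" for a b
  proof -
    have "((\<lambda>b. x + a *\<^sub>R u + b *\<^sub>R v) has_derivative (\<lambda>h. h *\<^sub>R v)) (at b)"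
      by (auto intro!: derivative_eq_intros)
    from has_derivative_compose [OF this g' [OF assms(3) [OF that]]]
    have "((\<lambda>b. g (x + a *\<^sub>R u + b *\<^sub>R v)) has_derivative
        (\<lambda>h. frechet_derivative g (at (x + a *\<^sub>R u + b *\<^sub>R v)) (h *\<^sub>R v))) (at b)" .
    then show ?thesis
      using linear_scale [OF has_derivative_linear [OF g' [OF assms(3) [OF that]]]]
      by (simp add: has_field_derivative_def mult_commute_abs)
  qed
  have df': "((\<lambda>a. f (x + a *\<^sub>R u + t *\<^sub>R v) - f (x + a *\<^sub>R u + 0 *\<^sub>R v))
      has_real_derivative g (x + a *\<^sub>R u + t *\<^sub>R v) - g (x + a *\<^sub>R u + 0 *\<^sub>R v)) (at a)"
    if "0 \<le> a" "a \<le> t" for a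
    using that assms(2) by (intro DERIV_diff df) auto
  obtain a where a: "0 < a" "a < t" and fa:
    "f (x + t *\<^sub>R u + t *\<^sub>R v) - f (x + t *\<^sub>R u + 0 *\<^sub>R v)
      - (f (x + 0 *\<^sub>R u + t *\<^sub>R v) - f (x + 0 *\<^sub>R u + 0 *\<^sub>R v))
     = (t - 0) * (g (x + a *\<^sub>R u + t *\<^sub>R v) - g (x + a *\<^sub>R u + 0 *\<^sub>R v))"
    using MVT2 [OF assms(2) df']
    by blast
  obtain b where b: "0 < b" "b < t" and gb:
    "g (x + a *\<^sub>R u + t *\<^sub>R v) - g (x + a *\<^sub>R u + 0 *\<^sub>R v)
     = (t - 0) * frechet_derivative g (at (x + a *\<^sub>R u + b *\<^sub>R v)) v"
    using MVT2 [OF assms(2), of "\<lambda>b. g (x + a *\<^sub>R u + b *\<^sub>R v)"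
        "\<lambda>b. frechet_derivative g (at (x + a *\<^sub>R u + b *\<^sub>R v)) v"] dg a by auto
  show ?thesis
    using a b fa gb unfolding g_def [symmetric]
    by (intro bexI [of _ a] bexI [of _ b]) (auto simp: power2_eq_square algebra_simps)
qed

lemma frechet_derivative_commute_real:
  fixes f :: "'a::real_normed_vector \<Rightarrow> real"
  assumes "open S" "x \<in> S" "Ck_on 2 f S"
  shows "frechet_derivative (\<lambda>y. frechet_derivative f (at y) u) (at x) v =
    frechet_derivative (\<lambda>y. frechet_derivative f (at y) v) (at x) u"
proof (rule ccontr)
  define F where "F u v y = frechet_derivative (\<lambda>y. frechet_derivative f (at y) u) (at y) v" for u v y
  assume "\<not> ?thesis"
  then have e: "0 < \<bar>F u v x - F v u x\<bar> / 2" (is "0 < ?e")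
    by (simp add: F_def)
  have "continuous_on S (F u v)" for u v
    using assms(3) by (simp add: F_def numeral_2_eq_2)
  then have cont: "(F u v \<longlongrightarrow> F u v x) (at x)" for u v
    using assms(1,2) by (metis continuous_on_eq_continuous_at isCont_def)
  have "\<forall>\<^sub>F y in at x. dist (F u v y) (F u v x) < ?e \<and> dist (F v u y) (F v u x) < ?e \<and> y \<in> S"
    using tendstoD [OF cont e] eventually_at_in_open' [OF assms(1,2)] by (simp add: eventually_conj)
  then obtain d where d: "d > 0" and dP: "\<And>y. \<lbrakk>y \<noteq> x; dist y x < d\<rbrakk> \<Longrightarrow>
      dist (F u v y) (F u v x) < ?e \<and> dist (F v u y) (F v u x) < ?e \<and> y \<in> S"
    unfolding eventually_at by blast
  have near: "dist (F u v y) (F u v x) < ?e \<and> dist (F v u y) (F v u x) < ?e \<and> y \<in> S"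
    if "dist y x < d" for y
    using dP that e assms(2) by (cases "y = x") auto
  define t where "t = d / (2 * (norm u + norm v + 1))"
  have pos: "norm u + norm v + 1 > 0"
    by (simp add: add_nonneg_pos)
  then have t: "0 < t"
    using d by (simp add: t_def)
  have dist: "dist (x + a *\<^sub>R u + b *\<^sub>R v) x < d" if "a \<in> {0..t}" "b \<in> {0..t}" for a b
  proof -
    have "norm (a *\<^sub>R u + b *\<^sub>R v) \<le> \<bar>a\<bar> * norm u + \<bar>b\<bar> * norm v"
      using norm_triangle_ineq [of "a *\<^sub>R u" "b *\<^sub>R v"] by simp
    also have "\<dots> \<le> t * norm u + t * norm v"
      using that by (intro add_mono mult_right_mono) auto
    also have "\<dots> \<le> t * (norm u + norm v + 1)"
      using t by (simp add: algebra_simps)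
    also have "\<dots> = d / 2"
      using pos unfolding t_def by (simp only: times_divide_eq_left divide_divide_eq_left)
        (simp add: nonzero_divide_eq_eq divide_eq_eq)
    also have "\<dots> < d"
      using d by simp
    finally show ?thesis
      by (simp add: dist_norm add.assoc)
  qed
  have S: "x + a *\<^sub>R u + b *\<^sub>R v \<in> S" if "a \<in> {0..t}" "b \<in> {0..t}" for a b
    using near [OF dist [OF that]] by blast
  obtain a b where ab: "a \<in> {0..t}" "b \<in> {0..t}" and
    1: "f (x + t *\<^sub>R u + t *\<^sub>R v) - f (x + t *\<^sub>R u) - f (x + t *\<^sub>R v) + f x =
      t\<^sup>2 * F u v (x + a *\<^sub>R u + b *\<^sub>R v)"
    using second_difference_mean_value [OF assms(3) t, of x u v] S unfolding F_def by blast
  have S': "x + b *\<^sub>R v + a *\<^sub>R u \<in> S" if "b \<in> {0..t}" "a \<in> {0..t}" for a b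
    using S [OF that(2,1)] by (simp add: algebra_simps)
  obtain b' a' where ab': "b' \<in> {0..t}" "a' \<in> {0..t}" and
    2: "f (x + t *\<^sub>R v + t *\<^sub>R u) - f (x + t *\<^sub>R v) - f (x + t *\<^sub>R u) + f x =
      t\<^sup>2 * F v u (x + b' *\<^sub>R v + a' *\<^sub>R u)"
    using second_difference_mean_value [OF assms(3) t, of x v u] S' unfolding F_def by blast
  have "t\<^sup>2 * F u v (x + a *\<^sub>R u + b *\<^sub>R v) = t\<^sup>2 * F v u (x + b' *\<^sub>R v + a' *\<^sub>R u)"
    using 1 2 by (simp add: algebra_simps)
  then have "F u v (x + a *\<^sub>R u + b *\<^sub>R v) = F v u (x + a' *\<^sub>R u + b' *\<^sub>R v)"
    using t by (simp add: algebra_simps)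
  moreover have "dist (F u v (x + a *\<^sub>R u + b *\<^sub>R v)) (F u v x) < ?e"
    "dist (F v u (x + a' *\<^sub>R u + b' *\<^sub>R v)) (F v u x) < ?e"
    using near [OF dist] ab ab' by blast+
  ultimately show False
    by (simp add: dist_real_def abs_if split: if_splits)
qed

lemma frechet_derivative_linear:
  assumes "bounded_linear L" "f differentiable at x"
  shows "frechet_derivative (\<lambda>y. L (f y)) (at x) v = L (frechet_derivative f (at x) v)"
  using frechet_derivative_at [OF bounded_linear.has_derivative [OF assms(1)
        assms(2) [unfolded frechet_derivative_works]]] by metis

lemma frechet_derivative_commute:
  fixes f :: "'a::real_normed_vector \<Rightarrow> 'b::euclidean_space"
  assumes "open S" "x \<in> S" "Ck_on 2 f S"
  shows "frechet_derivative (\<lambda>y. frechet_derivative f (at y) u) (at x) v =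
    frechet_derivative (\<lambda>y. frechet_derivative f (at y) v) (at x) u"
proof (rule euclidean_eqI)
  fix b :: 'b
  note L = bounded_linear_inner_left [of b]
  have C: "\<And>y. y \<in> S \<Longrightarrow> f differentiable at y"
    "\<And>u y. y \<in> S \<Longrightarrow> (\<lambda>z. frechet_derivative f (at z) u) differentiable at y"
    using assms(3) by (simp_all add: numeral_2_eq_2)
  have "frechet_derivative (\<lambda>y. frechet_derivative f (at y) u) (at x) v \<bullet> b =
    frechet_derivative (\<lambda>y. frechet_derivative (\<lambda>z. f z \<bullet> b) (at y) u) (at x) v" for u v
  proof -
    have d: "(\<lambda>y. frechet_derivative f (at y) u \<bullet> b) differentiable at x"
      using bounded_linear.has_derivative [OF L] C(2) [OF assms(2)] unfolding differentiable_def by blast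
    have "frechet_derivative (\<lambda>y. frechet_derivative f (at y) u \<bullet> b) (at x) =
        frechet_derivative (\<lambda>y. frechet_derivative (\<lambda>z. f z \<bullet> b) (at y) u) (at x)"
      by (rule frechet_derivative_transform_within_open [OF d assms(1,2)])
        (simp add: frechet_derivative_linear [OF L C(1)])
    then show ?thesis
      using frechet_derivative_linear [OF L C(2) [OF assms(2)]] by metis
  qed
  then show "frechet_derivative (\<lambda>y. frechet_derivative f (at y) u) (at x) v \<bullet> b =
    frechet_derivative (\<lambda>y. frechet_derivative f (at y) v) (at x) u \<bullet> b"
    using frechet_derivative_commute_real [OF assms(1,2) Ck_on_linear [OF L assms(1,3)]] by simp
qed

subsection \<open>Complex matrices, flat connections and line projections\<close>

lemma cscale_nth [simp]: "cscale c A $ i $ j = c * A $ i $ j"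
  by (simp add: cscale_def)

lemma conj_mat_nth [simp]: "conj_mat A $ i $ j = cnj (A $ i $ j)"
  by (simp add: conj_mat_def)

lemma cmat_nth [simp]: "cmat A $ i $ j = of_real (A $ i $ j)"
  by (simp add: cmat_def)

lemma matrix_add_rdistrib: "(A + B) ** C = A ** C + B ** (C :: 'a::semiring_1^'n^'m)"
  by (simp add: matrix_matrix_mult_def vec_eq_iff sum.distrib algebra_simps)

lemma matrix_diff_ldistrib: "A ** (B - C) = A ** B - A ** (C :: 'a::ring_1^'n^'m)"
  by (simp add: matrix_matrix_mult_def vec_eq_iff sum_subtractf algebra_simps)

lemma matrix_diff_rdistrib: "(A - B) ** C = A ** C - B ** (C :: 'a::ring_1^'n^'m)"
  by (simp add: matrix_matrix_mult_def vec_eq_iff sum_subtractf algebra_simps)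

lemma matrix_minus_left: "(- A) ** C = - (A ** (C :: 'a::ring_1^'n^'m))"
  by (simp add: matrix_matrix_mult_def vec_eq_iff sum_negf)

lemma matrix_minus_right: "A ** (- C) = - (A ** (C :: 'a::ring_1^'n^'m))"
  by (simp add: matrix_matrix_mult_def vec_eq_iff sum_negf)

lemma cscale_mult_left: "cscale c A ** B = cscale c (A ** B)"
  by (simp add: matrix_matrix_mult_def vec_eq_iff sum_distrib_left algebra_simps)

lemma cscale_mult_right: "A ** cscale c B = cscale c (A ** B)"
  by (simp add: matrix_matrix_mult_def vec_eq_iff sum_distrib_left algebra_simps)

lemma cscale_cscale: "cscale c (cscale d A) = cscale (c * d) A"
  by (simp add: vec_eq_iff)

lemmas matrix_expand =
  matrix_add_ldistrib matrix_add_rdistrib matrix_diff_ldistrib matrix_diff_rdistrib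
  matrix_minus_left matrix_minus_right cscale_mult_left cscale_mult_right
  matrix_mul_assoc [symmetric]

lemma conj_mat_mult: "conj_mat (A ** B) = conj_mat A ** conj_mat B"
  by (simp add: matrix_matrix_mult_def vec_eq_iff)

lemma conj_mat_add: "conj_mat (A + B) = conj_mat A + conj_mat B"
  and conj_mat_diff: "conj_mat (A - B) = conj_mat A - conj_mat B"
  and conj_mat_cscale: "conj_mat (cscale c A) = cscale (cnj c) (conj_mat A)"
  and conj_mat_mat_1 [simp]: "conj_mat (mat 1) = mat 1"
  and conj_mat_conj_mat [simp]: "conj_mat (conj_mat A) = A"
  by (simp_all add: vec_eq_iff mat_def)

lemma bounded_bilinear_matrix_mult:
  "bounded_bilinear ((**) :: complex^'n^'m \<Rightarrow> complex^'p^'n \<Rightarrow> complex^'p^'m)"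
  unfolding bilinear_conv_bounded_bilinear [symmetric] bilinear_def
  by (auto intro!: linearI simp: matrix_matrix_mult_def vec_eq_iff sum.distrib scaleR_sum_right
      algebra_simps)

lemma bounded_bilinear_cscale:
  "bounded_bilinear (cscale :: complex \<Rightarrow> complex^'c^'r \<Rightarrow> complex^'c^'r)"
  unfolding bilinear_conv_bounded_bilinear [symmetric] bilinear_def
  by (auto intro!: linearI simp: vec_eq_iff algebra_simps)

lemma bounded_linear_conj_mat: "bounded_linear (conj_mat :: complex^'c^'r \<Rightarrow> complex^'c^'r)"
  unfolding linear_conv_bounded_linear [symmetric]
  by (auto intro!: linearI simp: vec_eq_iff)

lemma bounded_linear_transpose:
  "bounded_linear (transpose :: complex^'c^'r \<Rightarrow> complex^'r^'c)"
  unfolding linear_conv_bounded_linear [symmetric]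
  by (auto intro!: linearI simp: vec_eq_iff transpose_def)

lemma bounded_bilinear_matrix_vector_mult:
  "bounded_bilinear ((*v) :: complex^'n^'m \<Rightarrow> complex^'n \<Rightarrow> complex^'m)"
  unfolding bilinear_conv_bounded_bilinear [symmetric] bilinear_def
  by (auto intro!: linearI simp: matrix_vector_mult_def vec_eq_iff sum.distrib scaleR_sum_right
      algebra_simps)

lemma flat_on_frame:
  fixes G :: "'a::real_normed_vector \<Rightarrow> complex^'c^'c"
  assumes "open S" "smooth_on S G"
    and inv: "\<And>x. x \<in> S \<Longrightarrow> invertible (G x)"
    and dG: "\<And>x v. x \<in> S \<Longrightarrow> frechet_derivative G (at x) v = G x ** \<theta> x v"
    and diff: "\<And>x v. x \<in> S \<Longrightarrow> (\<lambda>y. \<theta> y v) differentiable at x"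
  shows "flat_on S \<theta>"
  unfolding flat_on_def
proof (intro ballI allI)
  fix x u v assume x: "x \<in> S"
  define D where "D u v = frechet_derivative (\<lambda>y. \<theta> y v) (at x) u" for u v
  have snd: "frechet_derivative (\<lambda>y. frechet_derivative G (at y) v) (at x) u =
      G x ** D u v + G x ** \<theta> x u ** \<theta> x v" for u v
  proof -
    have "((\<lambda>y. G y ** \<theta> y v) has_derivative
        (\<lambda>u. G x ** D u v + frechet_derivative G (at x) u ** \<theta> x v)) (at x)"
      unfolding D_def
      using smooth_on_has_derivative [OF assms(2) x] diff [OF x] frechet_derivative_works
      by (intro bounded_bilinear.FDERIV [OF bounded_bilinear_matrix_mult]) blast+
    then have "((\<lambda>y. frechet_derivative G (at y) v) has_derivative
        (\<lambda>u. G x ** D u v + frechet_derivative G (at x) u ** \<theta> x v)) (at x)"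
      by (rule has_derivative_transform_within_open [OF _ assms(1) x]) (simp add: dG)
    from fun_cong [OF frechet_derivative_at [OF this, symmetric], of u] show ?thesis
      by (simp add: dG [OF x] matrix_mul_assoc)
  qed
  have "Ck_on 2 G S"
    using assms(2) by (simp add: smooth_on_def)
  from frechet_derivative_commute [OF assms(1) x this, of v u]
  have eq: "G x ** D u v + G x ** \<theta> x u ** \<theta> x v = G x ** D v u + G x ** \<theta> x v ** \<theta> x u"
    by (simp add: snd)
  have "G x ** (ext_deriv \<theta> x u v + wedge \<theta> \<theta> x u v) = 0"
    using eq unfolding ext_deriv_def wedge_def D_def [symmetric]
    by (simp add: matrix_expand) (simp add: algebra_simps)
  then have "matrix_inv (G x) ** (G x ** (ext_deriv \<theta> x u v + wedge \<theta> \<theta> x u v)) = 0"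
    by (simp add: matrix_matrix_mult_def vec_eq_iff)
  then show "ext_deriv \<theta> x u v + wedge \<theta> \<theta> x u v = 0"
    using matrix_inv_mult(1) [OF inv [OF x]] by (simp add: matrix_mul_assoc)
qed

definition cdot :: "complex^'c \<Rightarrow> complex^'c \<Rightarrow> complex" where
  "cdot u v = (\<Sum>i\<in>UNIV. u $ i * v $ i)"

definition tensor :: "complex^'r \<Rightarrow> complex^'c \<Rightarrow> complex^'c^'r" where
  "tensor u v = (\<chi> i j. u $ i * v $ j)"

definition conj_vec :: "complex^'c \<Rightarrow> complex^'c" where
  "conj_vec u = (\<chi> i. cnj (u $ i))"

lemma cdot_commute: "cdot u v = cdot v u"
  by (simp add: cdot_def mult.commute)

lemma cdot_minus_right: "cdot u (- v) = - cdot u v"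
  by (simp add: cdot_def sum_negf)

lemma cdot_matrix_vector: "cdot (M *v u) v = cdot u (transpose M *v v)"
proof -
  have "cdot (M *v u) v = (\<Sum>i\<in>UNIV. \<Sum>j\<in>UNIV. M $ i $ j * u $ j * v $ i)"
    by (simp add: cdot_def matrix_vector_mult_def sum_distrib_right)
  also have "\<dots> = (\<Sum>j\<in>UNIV. \<Sum>i\<in>UNIV. M $ i $ j * u $ j * v $ i)"
    by (rule sum.swap)
  also have "\<dots> = cdot u (transpose M *v v)"
    by (simp add: cdot_def matrix_vector_mult_def transpose_def sum_distrib_left ac_simps)
  finally show ?thesis .
qed

lemma matrix_mult_tensor: "M ** tensor u v = tensor (M *v u) v"
  by (simp add: tensor_def vec_eq_iff matrix_matrix_mult_def matrix_vector_mult_def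
      sum_distrib_right mult.assoc)

lemma tensor_mult_matrix: "tensor u v ** M = tensor u (transpose M *v v)"
  by (simp add: tensor_def vec_eq_iff matrix_matrix_mult_def matrix_vector_mult_def transpose_def
      sum_distrib_left ac_simps)

lemma tensor_mult_tensor: "tensor u v ** tensor w z = cscale (cdot v w) (tensor u z)"
  by (simp add: tensor_def cdot_def vec_eq_iff matrix_matrix_mult_def
      sum_distrib_left sum_distrib_right ac_simps)

lemma tensor_mult_vec: "tensor u v *v w = cdot v w *s u"
  by (simp add: tensor_def cdot_def vec_eq_iff matrix_vector_mult_def
      sum_distrib_left sum_distrib_right ac_simps)

lemma trace_tensor: "trace (tensor u v) = cdot u v"
  by (simp add: tensor_def cdot_def trace_def)

lemma conj_mat_tensor: "conj_mat (tensor u v) = tensor (conj_vec u) (conj_vec v)"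
  by (simp add: tensor_def conj_vec_def vec_eq_iff)

lemma conj_vec_matrix_vector: "conj_vec (M *v u) = conj_mat M *v conj_vec u"
  by (simp add: conj_vec_def conj_mat_vec)

lemma conj_vec_conj_vec [simp]: "conj_vec (conj_vec u) = u"
  by (simp add: conj_vec_def)

lemma cnj_cdot: "cnj (cdot u v) = cdot (conj_vec u) (conj_vec v)"
  by (simp add: cdot_def conj_vec_def)

lemma bounded_bilinear_tensor:
  "bounded_bilinear (tensor :: complex^'r \<Rightarrow> complex^'c \<Rightarrow> complex^'c^'r)"
  unfolding bilinear_conv_bounded_bilinear [symmetric] bilinear_def
  by (auto intro!: linearI simp: tensor_def vec_eq_iff algebra_simps)

lemma bounded_linear_conj_vec: "bounded_linear (conj_vec :: complex^'c \<Rightarrow> complex^'c)"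
  unfolding linear_conv_bounded_linear [symmetric]
  by (auto intro!: linearI simp: conj_vec_def vec_eq_iff)

lemma bounded_linear_trace: "bounded_linear (trace :: complex^'c^'c \<Rightarrow> complex)"
  unfolding linear_conv_bounded_linear [symmetric]
  by (auto intro!: linearI simp: trace_def sum.distrib scaleR_sum_right)

lemma cdot_skew:
  assumes "transpose S = S" "transpose X ** S = - (S ** X)"
  shows "cdot (S *v u) (X *v u) = 0"
proof -
  have "cdot (S *v u) (X *v u) = cdot u (S *v (X *v u))"
    by (simp add: cdot_matrix_vector assms(1))
  also have "\<dots> = - cdot u (transpose X *v (S *v u))"
  proof -
    have "S *v (X *v u) = - (transpose X *v (S *v u))"
      unfolding matrix_vector_mul_assoc assms(2)
      by (simp add: matrix_vector_mult_def vec_eq_iff sum_negf)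
    then show ?thesis by (simp add: cdot_minus_right)
  qed
  also have "\<dots> = - cdot (S *v u) (X *v u)"
    by (metis cdot_commute cdot_matrix_vector)
  finally show ?thesis by simp
qed

text \<open>Projection onto the line of \<open>u\<close> along its complement for the Hermitian form
  \<open>(u, v) \<mapsto> u\<^sup>* S v\<close>; junk (zero) on null vectors.\<close>

definition line_proj :: "complex^'c^'c \<Rightarrow> complex^'c \<Rightarrow> complex^'c^'c" where
  "line_proj S u = cscale (inverse (cdot u (S *v conj_vec u))) (tensor u (S *v conj_vec u))"

context
  fixes S :: "complex^'c^'c" and u :: "complex^'c"
  assumes S: "transpose S = S" "conj_mat S = S"
    and nonnull: "cdot u (S *v conj_vec u) \<noteq> 0"
begin

lemma conj_line_proj:
  "conj_mat (line_proj S u) = cscale (inverse (cdot u (S *v conj_vec u))) (tensor (conj_vec u) (S *v u))"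
proof -
  have "cnj (cdot u (S *v conj_vec u)) = cdot u (S *v conj_vec u)"
    by (simp add: cnj_cdot conj_vec_matrix_vector S) (metis S(1) cdot_commute cdot_matrix_vector)
  then show ?thesis
    by (simp add: line_proj_def conj_mat_cscale conj_mat_tensor conj_vec_matrix_vector S)
qed

lemma line_proj_idem: "line_proj S u ** line_proj S u = line_proj S u"
  using nonnull
  by (simp add: line_proj_def cscale_mult_left cscale_mult_right tensor_mult_tensor cscale_cscale
      cdot_commute [of "S *v conj_vec u" u])

lemma line_proj_skew:
  assumes "transpose X ** S = - (S ** X)"
  shows "conj_mat (line_proj S u) ** (X ** line_proj S u) = 0"
  unfolding conj_line_proj
  unfolding line_proj_def cscale_mult_left cscale_mult_right matrix_mult_tensor [of X]
    tensor_mult_tensor cdot_skew [OF S(1) assms]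
  by (simp add: vec_eq_iff)

lemma line_proj_isotropic:
  assumes "cdot u (S *v u) = 0"
  shows "conj_mat (line_proj S u) ** line_proj S u = 0"
  using assms unfolding conj_line_proj unfolding line_proj_def cscale_mult_left cscale_mult_right
    tensor_mult_tensor by (simp add: vec_eq_iff cdot_commute)

lemma line_proj_adjoint: "transpose (line_proj S u) ** S = S ** conj_mat (line_proj S u)"
proof -
  have "transpose (line_proj S u) =
      cscale (inverse (cdot u (S *v conj_vec u))) (tensor (S *v conj_vec u) u)"
    by (simp add: line_proj_def transpose_def tensor_def vec_eq_iff)
  then show ?thesis
    unfolding conj_line_proj
    by (simp add: cscale_mult_left cscale_mult_right tensor_mult_matrix [of _ _ S] S(1)
        matrix_mult_tensor [of S] del: transpose_matrix_vector)
qed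

lemma line_proj_parity:
  assumes "transpose K = K" "K ** K = mat 1" "K ** S = S ** K" "K *v u = conj_vec u"
  shows "K ** line_proj S u ** K = conj_mat (line_proj S u)"
proof -
  have "K *v conj_vec u = u"
    using assms(2) by (simp add: assms(4) [symmetric] matrix_vector_mul_assoc)
  then have "K *v (S *v conj_vec u) = S *v u"
    by (metis assms(3) matrix_vector_mul_assoc)
  then show ?thesis
    unfolding conj_line_proj unfolding line_proj_def
    by (simp add: cscale_mult_left cscale_mult_right matrix_mult_tensor [of K]
        tensor_mult_matrix [of _ _ K] assms del: transpose_matrix_vector)
qed

end

lemma line_proj_has_derivative:
  fixes u :: "'a::real_normed_vector \<Rightarrow> complex^'c" and s :: real
  assumes S: "transpose S = S" "conj_mat S = S"
    and nonnull: "cdot (u x) (S *v conj_vec (u x)) \<noteq> 0"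
    and real: "\<And>v. conj_mat (a v) = a v" "\<And>v. conj_mat (b v) = b v"
    and skew: "\<And>v. transpose (a v) ** S = - (S ** a v)" "\<And>v. transpose (b v) ** S = - (S ** b v)"
    and du: "(u has_derivative (\<lambda>v. (cscale (\<i> * of_real s) (a v) - b v) *v u x)) (at x)"
  defines "P \<equiv> line_proj S (u x)"
  shows "((\<lambda>y. line_proj S (u y)) has_derivative
    (\<lambda>v. P ** b v - b v ** P + cscale (\<i> * of_real s)
       (P ** a v + a v ** P - cscale 2 (P ** (a v ** P))))) (at x)"
proof -
  define c where "c = \<i> * complex_of_real s"
  define w where "w y = S *v conj_vec (u y)" for y
  define K where "K y = tensor (u y) (w y)" for y
  define t where "t y = trace (K y)" for y
  have t: "t y = cdot (u y) (S *v conj_vec (u y))" for y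
    by (simp add: t_def K_def w_def trace_tensor)
  define K' where "K' v = (cscale c (a v) - b v) ** K x + K x ** (cscale c (a v) + b v)" for v
  have dw: "(w has_derivative (\<lambda>v. transpose (cscale c (a v) + b v) *v w x)) (at x)"
  proof -
    have "(w has_derivative (\<lambda>v. S *v conj_vec ((cscale c (a v) - b v) *v u x))) (at x)"
      unfolding w_def c_def
      by (intro bounded_linear.has_derivative [OF bounded_bilinear.bounded_linear_right
            [OF bounded_bilinear_matrix_vector_mult]]
          bounded_linear.has_derivative [OF bounded_linear_conj_vec] du)
    moreover have "S *v conj_vec ((cscale c (a v) - b v) *v u x) =
        transpose (cscale c (a v) + b v) *v w x" for v
    proof -
      have "conj_mat (cscale c (a v) - b v) = - (cscale c (a v) + b v)"
        using real [of v] by (simp add: vec_eq_iff c_def)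
      moreover have "transpose (cscale c (a v) + b v) ** S = - (S ** (cscale c (a v) + b v))"
      proof -
        have "transpose (cscale c (a v) + b v) = cscale c (transpose (a v)) + transpose (b v)"
          by (simp add: vec_eq_iff transpose_def)
        then show ?thesis
          by (simp add: matrix_expand skew) (simp add: vec_eq_iff)
      qed
      ultimately show ?thesis
        by (simp only: conj_vec_matrix_vector w_def matrix_vector_mul_assoc matrix_minus_right)
    qed
    ultimately show ?thesis by simp
  qed
  have dK: "(K has_derivative K') (at x)"
  proof -
    have "(K has_derivative (\<lambda>v. tensor (u x) (transpose (cscale c (a v) + b v) *v w x) +
        tensor ((cscale c (a v) - b v) *v u x) (w x))) (at x)"
      unfolding K_def
      by (rule bounded_bilinear.FDERIV [OF bounded_bilinear_tensor du [folded c_def] dw])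
    moreover have "(\<lambda>v. tensor (u x) (transpose (cscale c (a v) + b v) *v w x) +
        tensor ((cscale c (a v) - b v) *v u x) (w x)) = K'"
      by (simp only: fun_eq_iff K'_def K_def matrix_mult_tensor tensor_mult_matrix add.commute simp_thms)
    ultimately show ?thesis by simp
  qed
  have dt: "(t has_derivative (\<lambda>v. 2 * c * trace (a v ** K x))) (at x)"
  proof -
    have "(t has_derivative (\<lambda>v. trace (K' v))) (at x)"
      unfolding t_def by (rule bounded_linear.has_derivative [OF bounded_linear_trace dK])
    moreover have "trace (K' v) = 2 * c * trace (a v ** K x)" for v
    proof -
      have "trace (cscale c (a v) ** K x) = c * trace (a v ** K x)"
        by (simp add: cscale_mult_left trace_def sum_distrib_left)
      moreover have "trace (K x ** (cscale c (a v) + b v)) = trace ((cscale c (a v) + b v) ** K x)"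
        by (rule trace_mul_sym)
      ultimately show ?thesis
        by (simp add: K'_def trace_add trace_sub matrix_add_rdistrib matrix_diff_rdistrib)
    qed
    ultimately show ?thesis by simp
  qed
  have tx: "t x \<noteq> 0"
    using nonnull by (simp add: t)
  have Kt: "line_proj S (u y) = cscale (inverse (t y)) (K y)" for y
    by (simp add: line_proj_def t K_def w_def)
  have "((\<lambda>y. cscale (inverse (t y)) (K y)) has_derivative
      (\<lambda>v. cscale (inverse (t x)) (K' v) +
        cscale (- (inverse (t x) * (2 * c * trace (a v ** K x)) * inverse (t x))) (K x))) (at x)"
    by (intro bounded_bilinear.FDERIV [OF bounded_bilinear_cscale] Deriv.has_derivative_inverse tx dt dK)
  moreover have "cscale (inverse (t x)) (K' v) +
        cscale (- (inverse (t x) * (2 * c * trace (a v ** K x)) * inverse (t x))) (K x) =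
      P ** b v - b v ** P + cscale c (P ** a v + a v ** P - cscale 2 (P ** (a v ** P)))" for v
  proof -
    have "K x ** (a v ** K x) = cscale (trace (a v ** K x)) (K x)"
      by (simp add: K_def matrix_mult_tensor [of "a v"] tensor_mult_tensor trace_tensor cdot_commute)
    then show ?thesis
      unfolding P_def Kt K'_def
      by (simp add: matrix_expand cscale_cscale) (simp add: vec_eq_iff algebra_simps)
  qed
  ultimately show ?thesis
    unfolding Kt c_def [symmetric] by simp
qed

text \<open>Here \<open>1 + e P + f Q\<close> is the inverse of the simple element, and the derivatives \<open>P', Q'\<close> are
  exactly those for which the residues at \<open>\<mu> = \<plusminus> c\<close> cancel.\<close>

lemma dressing_identity:
  fixes P Q a b :: "complex^'c^'c" and c \<mu> :: complex
  defines "e \<equiv> - 2 * c / (\<mu> + c)" and "f \<equiv> 2 * c / (\<mu> - c)"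
  assumes "\<mu> \<noteq> c" "\<mu> \<noteq> - c"
    and "P ** P = P" "Q ** Q = Q" "Q ** (a ** P) = 0" "P ** (a ** Q) = 0"
    and "b' = b - cscale (2 * c) (a ** (P - Q) - (P - Q) ** a)"
    and "P' = P ** b - b ** P + cscale c (P ** a + a ** P - cscale 2 (P ** (a ** P)))"
    and "Q' = Q ** b - b ** Q - cscale c (Q ** a + a ** Q - cscale 2 (Q ** (a ** Q)))"
    and PQ: "P ** Q = 0" "Q ** P = 0"
  shows "cscale e P' + cscale f Q' =
    (mat 1 + cscale e P + cscale f Q) ** (cscale \<mu> a + b') -
    (cscale \<mu> a + b) ** (mat 1 + cscale e P + cscale f Q)"
proof -
  have PP: "P ** (P ** X) = P ** X" "Q ** (Q ** X) = Q ** X" "P ** (Q ** X) = 0" "Q ** (P ** X) = 0"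
    for X using assms by (simp_all add: matrix_mul_assoc)
  have 0: "cscale k 0 = (0 :: complex^'c^'c)" for k
    by (simp add: vec_eq_iff)
  have e: "\<mu> * e = - c * e - 2 * c" "\<mu> * f = c * f + 2 * c"
  proof -
    have "\<mu> + c \<noteq> 0" "\<mu> - c \<noteq> 0"
      using assms(3,4) by (simp_all add: eq_neg_iff_add_eq_0)
    then show "\<mu> * e = - c * e - 2 * c" "\<mu> * f = c * f + 2 * c"
      by (simp_all add: e_def f_def field_simps)
  qed
  show ?thesis
    unfolding assms(9-11)
    apply (simp add: matrix_expand cscale_cscale PP PQ assms(5-8) 0)
    apply (simp add: vec_eq_iff)
    apply (intro allI)
    subgoal for i j using e by algebra
    done
qed

subsection \<open>The connection form of the system\<close>

lemma pos_inject [simp]: "pos i = pos j \<longleftrightarrow> i = (j :: 'i::{finite,linorder})"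
proof -
  have less: "pos i < pos j" if "i < j" for i j :: 'i
    unfolding pos_def by (rule psubset_card_mono) (use that in auto)
  show ?thesis
    using less [of i j] less [of j i] by (cases i j rule: linorder_cases) auto
qed

lemma J_mat_mult_nth: "(J_mat ** M) $ i $ j = (if i = last_index then - M $ i $ j else M $ i $ j)"
proof -
  have "(J_mat ** M) $ i $ j =
      (\<Sum>k\<in>UNIV. if k = i then (if i = last_index then - M $ i $ j else M $ i $ j) else 0)"
    unfolding matrix_matrix_mult_def J_mat_def vec_lambda_beta by (intro sum.cong refl) auto
  then show ?thesis by simp
qed

lemma mult_J_mat_nth: "(M ** J_mat) $ i $ j = (if j = last_index then - M $ i $ j else M $ i $ j)"
proof -
  have "(M ** J_mat) $ i $ j =
      (\<Sum>k\<in>UNIV. if k = j then (if j = last_index then - M $ i $ j else M $ i $ j) else 0)"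
    unfolding matrix_matrix_mult_def J_mat_def vec_lambda_beta by (intro sum.cong refl) auto
  then show ?thesis by simp
qed

lemma transpose_J_mat [simp]: "transpose J_mat = J_mat"
  by (auto simp: transpose_def J_mat_def vec_eq_iff)

lemma J_mat_square [simp]: "J_mat ** J_mat = mat 1"
  by (simp add: vec_eq_iff J_mat_mult_nth) (simp add: J_mat_def mat_def)

lemma J_mat_cancel: "J_mat ** (J_mat ** M) = M"
  by (simp add: matrix_mul_assoc)

lemma cmat_J_mat [simp]: "cmat J_mat = J_mat"
  by (simp add: vec_eq_iff J_mat_def)

lemma block_nth [simp]:
  "block P Q R S $ Inl a $ Inl b = P $ a $ b" "block P Q R S $ Inl a $ Inr d = Q $ a $ d"
  "block P Q R S $ Inr c $ Inl b = R $ c $ b" "block P Q R S $ Inr c $ Inr d = S $ c $ d"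
  by (simp_all add: block_def)

lemma block_eq_iff:
  "M = N \<longleftrightarrow> (\<forall>a b. M $ Inl a $ Inl b = N $ Inl a $ Inl b) \<and> (\<forall>a d. M $ Inl a $ Inr d = N $ Inl a $ Inr d) \<and>
    (\<forall>c b. M $ Inr c $ Inl b = N $ Inr c $ Inl b) \<and> (\<forall>c d. M $ Inr c $ Inr d = N $ Inr c $ Inr d)"
  by (auto simp: vec_eq_iff split_sum_all)

lemma block_mult:
  fixes P P' :: "'a::semiring_1^'m::finite^'m" and Q Q' :: "'a^'k::finite^'m"
  shows "block P Q R S ** block P' Q' R' S' =
    block (P ** P' + Q ** R') (P ** Q' + Q ** S') (R ** P' + S ** R') (R ** Q' + S ** S')"
  unfolding block_eq_iff by (simp add: matrix_matrix_mult_def block_sum_univ)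

lemma transpose_block:
  "transpose (block P Q R S) = block (transpose P) (transpose R) (transpose Q) (transpose S)"
  unfolding block_eq_iff by (simp add: transpose_def)

lemma cmat_mult: "cmat (A ** B) = cmat A ** cmat B"
  by (simp add: vec_eq_iff matrix_matrix_mult_def)

lemma cmat_diff: "cmat (A - B) = cmat A - cmat B"
  and conj_mat_cmat [simp]: "conj_mat (cmat A) = cmat A"
  and transpose_cmat: "transpose (cmat A) = cmat (transpose A)"
  by (simp_all add: vec_eq_iff transpose_def)

lemma mat_1_block: "mat 1 = block (mat 1) 0 0 (mat 1)"
  unfolding block_eq_iff by (simp add: mat_def)

lemma I_nm_1_cmat: "(I_nm_1 :: ('m::finite, 'k::{finite,linorder}) cblock) = cmat (block (mat 1) 0 0 J_mat)"
  unfolding I_nm_1_def block_eq_iff by (simp add: mat_def J_mat_def)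

lemma I_nm_1_square [simp]: "I_nm_1 ** I_nm_1 = mat 1"
  by (simp add: I_nm_1_def block_mult mat_1_block [symmetric])

lemma transpose_I_nm_1 [simp]: "transpose I_nm_1 = I_nm_1"
  unfolding I_nm_1_def transpose_block by (simp add: transpose_mat) (simp add: transpose_def zero_vec_def)

lemma conj_I_nm_1 [simp]: "conj_mat I_nm_1 = I_nm_1"
  by (simp add: I_nm_1_cmat)

lemma I_m_n1_cancel: "I_m_n1 ** (I_m_n1 ** M) = M"
  by (simp add: matrix_mul_assoc I_m_n1_square)

lemma transpose_I_m_n1 [simp]: "transpose I_m_n1 = I_m_n1"
  unfolding I_m_n1_def block_eq_iff by (auto simp: transpose_def mat_def)

lemma I_m_n1_commute: "I_m_n1 ** I_nm_1 = I_nm_1 ** I_m_n1"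
  unfolding I_m_n1_def I_nm_1_def block_mult by (simp add: matrix_minus_left matrix_minus_right)

definition lead_real :: "'k::{finite,linorder} \<Rightarrow> real^('m::{finite,linorder} + 'k)^('m + 'k)" where
  "lead_real i = block 0 (- (D_mat i ** J_mat)) (transpose (D_mat i)) 0"

definition pot_real :: "real^'k::{finite,linorder}^'m::{finite,linorder} \<Rightarrow> real^('m + 'k)^('m + 'k)" where
  "pot_real y = block 0 y (- (J_mat ** transpose y)) 0"

definition lead :: "'k::{finite,linorder} rvec \<Rightarrow> ('m::{finite,linorder}, 'k) cblock" where
  "lead v = (\<Sum>i\<in>UNIV. v $ i *\<^sub>R cmat (lead_real i))"

definition brk :: "'k::{finite,linorder} rvec \<Rightarrow> ('m::{finite,linorder}, 'k) rmat \<Rightarrow> ('m, 'k) cblock" where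
  "brk v y = lead v ** cmat (pot_real y) - cmat (pot_real y) ** lead v"

lemma lead_pot_commutator:
  "lead_real i ** pot_real y - pot_real y ** lead_real i =
    block (D_mat i ** transpose y - y ** transpose (D_mat i)) 0
      0 (transpose (D_mat i) ** y - J_mat ** transpose y ** D_mat i ** J_mat)"
  unfolding lead_real_def pot_real_def block_mult
  by (simp add: matrix_minus_left matrix_minus_right matrix_mul_assoc [symmetric] J_mat_cancel
      block_eq_iff)

lemma theta_eq: "theta \<xi> \<mu> x v = cscale \<mu> (lead v) + brk v (\<xi> x)"
proof -
  let ?p = "cmat (pot_real (\<xi> x))"
  have 1: "cscale \<mu> (lead v) = (\<Sum>i\<in>UNIV. v $ i *\<^sub>R cscale \<mu> (cmat (lead_real i)))"
    unfolding lead_def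
    by (simp add: bounded_bilinear.sum_right [OF bounded_bilinear_cscale]
        bounded_bilinear.scaleR_right [OF bounded_bilinear_cscale])
  have 2: "brk v (\<xi> x) = (\<Sum>i\<in>UNIV. v $ i *\<^sub>R (cmat (lead_real i) ** ?p - ?p ** cmat (lead_real i)))"
    unfolding brk_def lead_def
    by (simp add: bounded_bilinear.sum_right [OF bounded_bilinear_matrix_mult]
        bounded_bilinear.sum_left [OF bounded_bilinear_matrix_mult]
        bounded_bilinear.scaleR_right [OF bounded_bilinear_matrix_mult]
        bounded_bilinear.scaleR_left [OF bounded_bilinear_matrix_mult]
        scaleR_diff_right sum_subtractf)
  show ?thesis
    unfolding 1 2 theta_def lead_pot_commutator [symmetric] lead_real_def [symmetric]
    by (simp add: cmat_diff cmat_mult scaleR_add_right sum.distrib)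
qed

lemma conj_lead: "conj_mat (lead v) = lead v"
  by (simp add: lead_def vec_eq_iff)

lemma conj_brk: "conj_mat (brk v y) = brk v y"
  by (simp add: brk_def conj_mat_diff conj_mat_mult conj_lead)

lemma lead_real_skew:
  "transpose (lead_real i) ** block (mat 1) 0 0 J_mat = - (block (mat 1) 0 0 J_mat ** lead_real i)"
  unfolding lead_real_def transpose_block block_mult
  by (simp add: block_eq_iff J_mat_mult_nth mult_J_mat_nth) (simp add: transpose_def mult_J_mat_nth)

lemma pot_real_skew:
  "transpose (pot_real y) ** block (mat 1) 0 0 J_mat = - (block (mat 1) 0 0 J_mat ** pot_real y)"
  unfolding pot_real_def transpose_block block_mult
  by (simp add: block_eq_iff J_mat_mult_nth mult_J_mat_nth) (simp add: transpose_def J_mat_mult_nth)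

lemma cmat_skew:
  fixes X :: "real^('m::finite + 'k::{finite,linorder})^('m + 'k)"
  assumes "transpose X ** block (mat 1) 0 0 J_mat = - (block (mat 1) 0 0 J_mat ** X)"
  shows "transpose (cmat X) ** I_nm_1 = - (I_nm_1 ** cmat X)"
proof -
  have "cmat (- Y) = - cmat Y" for Y :: "real^('m + 'k)^('m + 'k)"
    by (simp add: vec_eq_iff)
  then show ?thesis
    unfolding I_nm_1_cmat transpose_cmat cmat_mult [symmetric] assms by simp
qed

lemma lead_skew:
  "transpose (lead v) ** I_nm_1 =
    - (I_nm_1 ** (lead v :: ('m::{finite,linorder}, 'k::{finite,linorder}) cblock))"
proof -
  have "transpose (lead v :: ('m, 'k) cblock) = (\<Sum>i\<in>UNIV. v $ i *\<^sub>R transpose (cmat (lead_real i)))"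
    by (simp add: lead_def transpose_def vec_eq_iff)
  then show ?thesis
    unfolding lead_def
    by (simp add: bounded_bilinear.sum_right [OF bounded_bilinear_matrix_mult]
        bounded_bilinear.sum_left [OF bounded_bilinear_matrix_mult]
        bounded_bilinear.scaleR_right [OF bounded_bilinear_matrix_mult]
        bounded_bilinear.scaleR_left [OF bounded_bilinear_matrix_mult]
        cmat_skew [OF lead_real_skew] sum_negf)
qed

lemma commutator_skew:
  fixes S X Y :: "complex^'c^'c"
  assumes "transpose X ** S = - (S ** X)" "transpose Y ** S = - (S ** Y)"
  shows "transpose (X ** Y - Y ** X) ** S = - (S ** (X ** Y - Y ** X))"
proof -
  have *: "transpose (X ** Y) ** S = S ** Y ** X"
    if "transpose X ** S = - (S ** X)" "transpose Y ** S = - (S ** Y)" for X Y :: "complex^'c^'c"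
  proof -
    have "transpose (X ** Y) ** S = transpose Y ** (transpose X ** S)"
      by (simp add: matrix_transpose_mul matrix_mul_assoc)
    also have "\<dots> = - (transpose Y ** S ** X)"
      by (simp add: that(1) matrix_minus_right matrix_mul_assoc)
    finally show ?thesis
      by (simp add: that(2) matrix_minus_left)
  qed
  have "transpose (X ** Y - Y ** X) = transpose (X ** Y) - transpose (Y ** X)"
    by (simp add: transpose_def vec_eq_iff)
  then show ?thesis
    by (simp add: matrix_diff_rdistrib matrix_diff_ldistrib * assms matrix_mul_assoc)
qed

lemma brk_skew: "transpose (brk v y) ** I_nm_1 = - (I_nm_1 ** brk v y)"
  unfolding brk_def by (rule commutator_skew [OF lead_skew cmat_skew [OF pot_real_skew]])

lemma linear_pot: "linear (\<lambda>y. cmat (pot_real y))"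
proof (rule linearI)
  have "pot_real (y + z) = pot_real y + pot_real z" "pot_real (r *\<^sub>R y) = r *\<^sub>R pot_real y"
    for y z :: "real^'a::{finite,linorder}^'b::{finite,linorder}" and r
    by (simp_all add: pot_real_def block_eq_iff J_mat_mult_nth) (simp_all add: transpose_def)
  then show "cmat (pot_real (y + z)) = cmat (pot_real y) + cmat (pot_real z)"
    "cmat (pot_real (r *\<^sub>R y)) = r *\<^sub>R cmat (pot_real y)"
    for y z :: "real^'a::{finite,linorder}^'b::{finite,linorder}" and r
    by (simp_all add: vec_eq_iff complex_eq_iff)
qed

lemma linear_brk: "linear (brk v)"
  unfolding brk_def
  by (intro linearI)
    (simp_all add: linear_add [OF linear_pot] linear_scale [OF linear_pot]
      matrix_add_ldistrib matrix_add_rdistrib scaleR_diff_right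
      bounded_bilinear.scaleR_right [OF bounded_bilinear_matrix_mult]
      bounded_bilinear.scaleR_left [OF bounded_bilinear_matrix_mult])

lemma D_mat_mult_nth:
  fixes y :: "real^'c^'k::{finite,linorder}"
  shows "(D_mat i ** y) $ a $ b = (if pos a = pos i then y $ i $ b else 0)"
  by (simp add: D_mat_def matrix_matrix_mult_def if_distrib [of "\<lambda>x. x * _"] cong: if_cong)

lemma lead_pot_commutator_diag:
  fixes y :: "('m::{finite,linorder}, 'k::{finite,linorder}) rmat"
  assumes "\<And>a b. pos a \<noteq> pos b \<Longrightarrow> y $ a $ b = 0"
  shows "lead_real i ** pot_real y = pot_real y ** lead_real i"
proof -
  have D: "D_mat i ** transpose y = y ** transpose (D_mat i)"
  proof -
    have T: "transpose M $ c $ d = M $ d $ c" for M :: "real^'c^'d" and c d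
      by (simp add: transpose_def)
    have "y ** transpose (D_mat i :: ('m, 'k) rmat) = transpose (D_mat i ** transpose y)"
      by (simp add: matrix_transpose_mul)
    then have "(y ** transpose (D_mat i)) $ a $ a' = (if pos a' = pos i then y $ a $ i else 0)" for a a' :: 'm
      by (simp add: T D_mat_mult_nth)
    moreover have "(D_mat i ** transpose y) $ a $ a' = (if pos a = pos i then y $ a' $ i else 0)" for a a' :: 'm
      by (simp add: D_mat_mult_nth) (simp add: transpose_def)
    moreover have "(if pos a = pos i then y $ a' $ i else 0) = (if pos a' = pos i then y $ a $ i else 0)"
      for a a' :: 'm
      using assms [of a i] assms [of a' i] by auto (metis pos_inject)
    ultimately show ?thesis
      by (simp add: vec_eq_iff)
  qed
  have E: "transpose (D_mat i) ** y = J_mat ** transpose y ** D_mat i ** J_mat"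
  proof -
    define g where "g = (\<Sum>a\<in>UNIV. if pos a = pos i then y $ a $ i else 0)"
    have T: "(transpose (D_mat i) ** y) $ b $ b' = (if b = i \<and> b' = i then g else 0)"
      "(transpose y ** D_mat i) $ b $ b' = (if b = i \<and> b' = i then g else 0)" for b b'
      using assms unfolding matrix_matrix_mult_def transpose_def D_mat_def g_def
      by (auto intro!: sum.cong sum.neutral)
    have "J_mat ** transpose y ** D_mat i ** J_mat = J_mat ** (transpose y ** D_mat i) ** J_mat"
      by (simp add: matrix_mul_assoc)
    then show ?thesis
      by (simp only:) (simp only: vec_eq_iff J_mat_mult_nth mult_J_mat_nth T, simp)
  qed
  have "lead_real i ** pot_real y - pot_real y ** lead_real i = 0"
    unfolding lead_pot_commutator D E by (simp add: block_eq_iff)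
  then show ?thesis by simp
qed

lemma brk_off_diag: "brk v (off_diag y) = brk v y"
proof -
  have "brk v (y - off_diag y) = 0"
    unfolding brk_def lead_def
    by (simp add: bounded_bilinear.sum_right [OF bounded_bilinear_matrix_mult]
        bounded_bilinear.sum_left [OF bounded_bilinear_matrix_mult]
        bounded_bilinear.scaleR_right [OF bounded_bilinear_matrix_mult]
        bounded_bilinear.scaleR_left [OF bounded_bilinear_matrix_mult]
        cmat_mult [symmetric] lead_pot_commutator_diag off_diag_def)
  then show ?thesis
    by (simp add: linear_diff [OF linear_brk])
qed

text \<open>The curvature is a quadratic polynomial in \<open>\<mu>\<close>, so the three values \<open>0, \<plusminus> 2 c\<close> determine it.\<close>

lemma flat_on_theta:
  fixes \<xi> :: "'k::{finite,linorder} rvec \<Rightarrow> ('m::{finite,linorder}, 'k) rmat" and c :: complex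
  assumes "open \<Omega>" "smooth_on \<Omega> \<xi>" "c \<noteq> 0"
    and flat: "\<And>\<mu>. \<lbrakk>\<mu> \<noteq> c; \<mu> \<noteq> - c\<rbrakk> \<Longrightarrow> flat_on \<Omega> (theta \<xi> \<mu>)"
  shows "flat_on \<Omega> (theta \<xi> \<mu>)"
  unfolding flat_on_def
proof (intro ballI allI)
  fix x u v assume x: "x \<in> \<Omega>"
  define D where "D u v = brk v (frechet_derivative \<xi> (at x) u)" for u v
  have d: "((\<lambda>y. theta \<xi> \<mu> y v) has_derivative (\<lambda>u. D u v)) (at x)" for \<mu> v
  proof -
    have "bounded_linear (brk v :: _ \<Rightarrow> ('m, 'k) cblock)"
      using linear_brk linear_conv_bounded_linear by blast
    from bounded_linear.has_derivative [OF this smooth_on_has_derivative [OF assms(2) x]]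
    show ?thesis
      unfolding theta_eq D_def using has_derivative_add [OF has_derivative_const] by fastforce
  qed
  define C0 where "C0 = D u v - D v u + (brk u (\<xi> x) ** brk v (\<xi> x) - brk v (\<xi> x) ** brk u (\<xi> x))"
  define C1 where "C1 = lead u ** brk v (\<xi> x) + brk u (\<xi> x) ** lead v
    - lead v ** brk u (\<xi> x) - brk v (\<xi> x) ** lead u"
  define C2 :: "('m, 'k) cblock" where "C2 = lead u ** lead v - lead v ** lead u"
  have F: "ext_deriv (theta \<xi> \<mu>) x u v + wedge (theta \<xi> \<mu>) (theta \<xi> \<mu>) x u v =
      C0 + cscale \<mu> C1 + cscale (\<mu> * \<mu>) C2" for \<mu>
    unfolding ext_deriv_def frechet_derivative_at [OF d, symmetric] unfolding wedge_def theta_eq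
      C0_def C1_def C2_def
    by (simp add: matrix_add_ldistrib matrix_add_rdistrib cscale_mult_left cscale_mult_right cscale_cscale)
      (simp add: vec_eq_iff algebra_simps)
  have Z: "C0 + cscale \<mu> C1 + cscale (\<mu> * \<mu>) C2 = 0" if "\<mu> \<noteq> c" "\<mu> \<noteq> - c" for \<mu>
    using flat [OF that] x F unfolding flat_on_def by metis
  have "C0 $ i $ j + \<mu> * C1 $ i $ j + \<mu> * \<mu> * C2 $ i $ j = 0" for i j
  proof -
    have e: "C0 $ i $ j + \<mu> * C1 $ i $ j + \<mu> * \<mu> * C2 $ i $ j = 0" if "\<mu> \<noteq> c" "\<mu> \<noteq> - c" for \<mu>
      using arg_cong [OF Z [OF that], of "\<lambda>M. M $ i $ j"] by (simp add: mult.assoc)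
    have "2 * c \<noteq> - c" "- (2 * c) \<noteq> c"
      using \<open>c \<noteq> 0\<close> by (auto simp: eq_neg_iff_add_eq_0 neg_eq_iff_add_eq_0)
    then have e3: "C0 $ i $ j = 0" "C0 $ i $ j + 2 * c * C1 $ i $ j + 2 * c * (2 * c) * C2 $ i $ j = 0"
      "C0 $ i $ j + - (2 * c) * C1 $ i $ j + - (2 * c) * - (2 * c) * C2 $ i $ j = 0"
      using e [of 0] e [of "2 * c"] e [of "- (2 * c)"] \<open>c \<noteq> 0\<close> by auto
    then have "c * c * C2 $ i $ j = 0" "c * C1 $ i $ j = 0"
      by algebra+
    then show ?thesis
      using \<open>c \<noteq> 0\<close> e3(1) by simp
  qed
  then show "ext_deriv (theta \<xi> \<mu>) x u v + wedge (theta \<xi> \<mu>) (theta \<xi> \<mu>) x u v = 0"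
    unfolding F by (simp add: vec_eq_iff)
qed

subsection \<open>The dressed frame\<close>

definition gauge :: "real \<Rightarrow> complex^'c^'c \<Rightarrow> complex \<Rightarrow> complex^'c^'c" where
  "gauge s P \<mu> = mat 1 + cscale (- 2 * (\<i> * of_real s) / (\<mu> + \<i> * of_real s)) P
    + cscale (2 * (\<i> * of_real s) / (\<mu> - \<i> * of_real s)) (conj_mat P)"

lemma cscale_0 [simp]: "cscale c 0 = 0"
  by (simp add: vec_eq_iff)

lemma gauge_coefficients:
  fixes c \<mu> :: complex
  assumes "\<mu> \<noteq> c" "\<mu> \<noteq> - c"
  shows "- 2 * c / (\<mu> + c) + 2 * c / (\<mu> - c) + - 2 * c / (\<mu> + c) * (2 * c / (\<mu> - c)) = 0"
    and "(\<mu> - c) / (\<mu> + c) = 1 + - 2 * c / (\<mu> + c)"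
    and "(\<mu> + c) / (\<mu> - c) = 1 + 2 * c / (\<mu> - c)"
proof -
  have "\<mu> + c \<noteq> 0" "\<mu> - c \<noteq> 0"
    using assms by (simp_all add: eq_neg_iff_add_eq_0)
  then show "- 2 * c / (\<mu> + c) + 2 * c / (\<mu> - c) + - 2 * c / (\<mu> + c) * (2 * c / (\<mu> - c)) = 0"
    and "(\<mu> - c) / (\<mu> + c) = 1 + - 2 * c / (\<mu> + c)"
    and "(\<mu> + c) / (\<mu> - c) = 1 + 2 * c / (\<mu> - c)"
    by (simp_all add: divide_simps) (simp_all add: algebra_simps)
qed

lemma orthogonal_idempotents_inverse:
  fixes P Q :: "complex^'c^'c"
  assumes "P ** P = P" "Q ** Q = Q" "P ** Q = 0" "Q ** P = 0" and ef: "e + f + e * f = 0"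
  shows "(mat 1 + cscale f P + cscale e Q) ** (mat 1 + cscale e P + cscale f Q) = mat 1"
    and "(P + cscale (1 + e) (mat 1 - P)) ** (Q + cscale (1 + f) (mat 1 - Q)) =
      mat 1 + cscale f P + cscale e Q"
proof -
  show "(mat 1 + cscale f P + cscale e Q) ** (mat 1 + cscale e P + cscale f Q) = mat 1"
    apply (simp add: matrix_expand assms(1-4) cscale_cscale)
    apply (simp add: vec_eq_iff)
    apply (intro allI)
    subgoal using ef by algebra
    done
  have C: "cscale k (A - B) = cscale k A - cscale k B" for k and A B :: "complex^'c^'c"
    by (simp add: vec_eq_iff algebra_simps)
  show "(P + cscale (1 + e) (mat 1 - P)) ** (Q + cscale (1 + f) (mat 1 - Q)) =
      mat 1 + cscale f P + cscale e Q"
    apply (simp add: matrix_expand C assms(1-4) cscale_cscale)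
    apply (simp add: vec_eq_iff)
    apply (intro allI)
    subgoal using ef by algebra
    done
qed

lemma matrix_inv_unique:
  fixes A B :: "complex^'c^'c"
  assumes "B ** A = mat 1"
  shows "invertible A" "matrix_inv A = B"
proof -
  show "invertible A"
    using assms invertible_left_inverse by blast
  then have "B ** (A ** matrix_inv A) = B"
    by (simp add: matrix_inv_mult)
  then show "matrix_inv A = B"
    by (simp add: matrix_mul_assoc assms)
qed

lemma matrix_inv_q_map:
  fixes P :: "complex^'c^'c"
  assumes "P ** P = P" "conj_mat P ** P = 0" "\<mu> \<noteq> \<i> * of_real s" "\<mu> \<noteq> - (\<i> * of_real s)"
  shows "matrix_inv (q_map s P \<mu>) = gauge s P \<mu>"
proof -
  note P = assms(1) arg_cong [OF assms(1), of conj_mat, unfolded conj_mat_mult]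
    arg_cong [OF assms(2), of conj_mat, unfolded conj_mat_mult conj_mat_conj_mat] assms(2)
  have "P ** conj_mat P = 0"
    using P(3) by (simp add: vec_eq_iff)
  note inv = orthogonal_idempotents_inverse [OF P(1,2) this P(4) gauge_coefficients(1) [OF assms(3,4)]]
  have q: "q_map s P \<mu> = mat 1 + cscale (2 * (\<i> * of_real s) / (\<mu> - \<i> * of_real s)) P
      + cscale (- 2 * (\<i> * of_real s) / (\<mu> + \<i> * of_real s)) (conj_mat P)"
    unfolding q_map_def gauge_coefficients(2,3) [OF assms(3,4)] by (rule inv(2))
  have "q_map s P \<mu> ** gauge s P \<mu> = mat 1"
    unfolding q gauge_def by (rule inv(1))
  then have "gauge s P \<mu> ** q_map s P \<mu> = mat 1"
    by (simp add: matrix_left_right_inverse)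
  then show ?thesis
    by (rule matrix_inv_unique)
qed

lemma conj_gauge: "conj_mat (gauge s P (cnj \<mu>)) = gauge s P \<mu>"
  unfolding gauge_def conj_mat_add conj_mat_cscale by (simp add: add.commute add.left_commute)

lemma parity_gauge:
  assumes "K ** K = mat 1" "K ** P ** K = conj_mat P"
  shows "K ** gauge s P \<mu> ** K = gauge s P (- \<mu>)"
proof -
  have K: "K ** conj_mat P ** K = P"
    unfolding assms(2) [symmetric] by (metis assms(1) matrix_mul_assoc matrix_mul_lid matrix_mul_rid)
  have "- \<mu> + c = - (\<mu> - c)" "- \<mu> - c = - (\<mu> + c)" for c
    by simp_all
  then have "- 2 * c / (- \<mu> + c) = 2 * c / (\<mu> - c)" "2 * c / (- \<mu> - c) = - 2 * c / (\<mu> + c)" for c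
    by (simp_all only: mult_minus_left divide_minus_left divide_minus_right minus_minus)
  then show ?thesis
    unfolding gauge_def
    by (simp add: matrix_add_ldistrib matrix_add_rdistrib cscale_mult_left cscale_mult_right assms K
        add.commute add.left_commute)
qed

lemma gauge_orthogonal:
  fixes P S :: "complex^'c^'c"
  assumes "P ** P = P" "conj_mat P ** P = 0" "\<mu> \<noteq> \<i> * of_real s" "\<mu> \<noteq> - (\<i> * of_real s)"
    and S: "transpose P ** S = S ** conj_mat P" "conj_mat S = S"
  shows "transpose (gauge s P \<mu>) ** S ** gauge s P \<mu> = S"
proof -
  define e where "e = - 2 * (\<i> * of_real s) / (\<mu> + \<i> * of_real s)"
  define f where "f = 2 * (\<i> * of_real s) / (\<mu> - \<i> * of_real s)"
  note P = assms(1) arg_cong [OF assms(1), of conj_mat, unfolded conj_mat_mult]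
    arg_cong [OF assms(2), of conj_mat, unfolded conj_mat_mult conj_mat_conj_mat] assms(2)
  have 0: "P ** conj_mat P = 0"
    using P(3) by (simp add: vec_eq_iff)
  have "conj_mat (transpose A) = transpose (conj_mat A)" for A :: "complex^'c^'c"
    by (simp add: vec_eq_iff transpose_def)
  then have S': "transpose (conj_mat P) ** S = S ** P"
    using arg_cong [OF S(1), of conj_mat] by (simp add: conj_mat_mult S(2))
  have "transpose (gauge s P \<mu>) = mat 1 + cscale e (transpose P) + cscale f (transpose (conj_mat P))"
    by (simp add: gauge_def e_def f_def vec_eq_iff transpose_def mat_def)
  then have "transpose (gauge s P \<mu>) ** S = S ** (mat 1 + cscale f P + cscale e (conj_mat P))"
    by (simp add: matrix_expand S(1) S' add.commute add.left_commute)
  moreover have "(mat 1 + cscale f P + cscale e (conj_mat P)) ** gauge s P \<mu> = mat 1"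
    unfolding gauge_def e_def f_def
    by (rule orthogonal_idempotents_inverse(1) [OF P(1,2) 0 P(4) gauge_coefficients(1) [OF assms(3,4)]])
  ultimately show ?thesis
    by (simp add: matrix_mul_assoc [symmetric])
qed

lemma I_nm_1_vec:
  fixes v :: "('m::finite, 'k::{finite,linorder}) cvec"
  shows "(I_nm_1 *v v) $ Inl a = v $ Inl a" "(I_nm_1 *v v) $ Inr b = (J_mat *v (\<chi> b. v $ Inr b)) $ b"
  by (auto simp: I_nm_1_def block_def matrix_vector_mult_def block_sum_univ mat_def
      if_distrib [of "\<lambda>x. x * _"] cong: if_cong)

lemma herm1_cdot: "herm1 u v = cdot (conj_vec u) (I_nm_1 *v v)"
  by (simp add: herm1_alt cdot_def conj_vec_def block_sum_univ I_nm_1_vec)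

lemma conj_lift_vec: "conj_vec (lift_vec w z) = I_m_n1 *v lift_vec w z"
proof -
  have "conj_vec (lift_vec w z) $ i = (I_m_n1 *v lift_vec w z) $ i" for i
    by (cases i) (simp_all add: conj_vec_def lift_vec_def I_m_n1_vec)
  then show ?thesis by (simp add: vec_eq_iff)
qed

lemma cdot_lift_vec:
  "cdot (lift_vec w z) (I_nm_1 *v lift_vec w z) = of_real (w \<bullet> w - z \<bullet> (J_mat *v z))"
  by (simp add: cdot_def block_sum_univ I_nm_1_vec J_mat_cvec lift_vec_def inner_vec_def
      sum_distrib_left algebra_simps sum_negf)

text \<open>The first identity turns the residue of the simple element into a change of the potential.\<close>

lemma orth_proj1_blocks:
  fixes w :: "'m::{finite,linorder} rvec" and z :: "'k::{finite,linorder} rvec"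
  assumes "w \<bullet> w = 1" "z \<bullet> (J_mat *v z) = 1" "is_orth_proj1 (vec.span {lift_vec w z}) P"
  shows "cmat (pot_real (outer w z ** J_mat)) = cscale \<i> (P - conj_mat P)"
    and "P + conj_mat P = cmat (block (outer w w) 0 0 (outer z z ** J_mat))"
proof -
  have P: "P = cscale (1 / 2) (block (cmat (outer w w)) (cscale (- \<i>) (cmat (outer w z ** J_mat)))
      (cscale \<i> (cmat (outer z w))) (cmat (outer z z ** J_mat)))"
    using assms(3) unfolding orth_proj1_closed_form [OF assms(1,2)]
    by (simp add: I_nm_1_def block_mult cscale_mult_left cmat_mult)
  have J: "J_mat ** transpose (outer w z ** J_mat) = outer z w"
  proof -
    have "transpose (outer w z ** J_mat) = J_mat ** outer z w"
      by (simp add: matrix_transpose_mul) (simp add: transpose_def outer_def mult.commute)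
    then show ?thesis by (simp add: J_mat_cancel)
  qed
  show "cmat (pot_real (outer w z ** J_mat)) = cscale \<i> (P - conj_mat P)"
    unfolding P pot_real_def J by (simp add: block_eq_iff algebra_simps)
  show "P + conj_mat P = cmat (block (outer w w) 0 0 (outer z z ** J_mat))"
    unfolding P by (simp add: block_eq_iff)
qed

locale simple_dressing =
  fixes \<Omega> :: "'k::{finite,linorder} rvec set"
    and \<xi> \<xi>t :: "'k rvec \<Rightarrow> ('m::{finite,linorder}, 'k) rmat"
    and E Et :: "'k rvec \<Rightarrow> complex \<Rightarrow> ('m, 'k) cblock"
    and s :: real
    and W :: "'m rvec" and Z :: "'k rvec"
    and Wt Wh :: "'k rvec \<Rightarrow> 'm rvec" and Zt Zh :: "'k rvec \<Rightarrow> 'k rvec"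
    and \<pi>t :: "'k rvec \<Rightarrow> ('m, 'k) cblock"
  assumes open_dom: "open \<Omega>"
    and solution: "G1_solution \<Omega> \<xi>"
    and frame: "G1_frame \<Omega> UNIV \<xi> E"
    and s: "s \<noteq> 0"
    and unit: "W \<bullet> W = 1" "Z \<bullet> (J_mat *v Z) = 1"
    and lift: "\<forall>x\<in>\<Omega>. lift_vec (Wt x) (Zt x) = matrix_inv (E x (- \<i> * of_real s)) *v lift_vec W Z"
    and Wt_nonzero: "\<forall>x\<in>\<Omega>. Wt x \<noteq> 0"
    and hat: "\<forall>x\<in>\<Omega>. Wh x = Wt x /\<^sub>R norm (Wt x) \<and> Zh x = Zt x /\<^sub>R norm_n1 (Zt x)"
    and proj: "\<forall>x\<in>\<Omega>. is_orth_proj1 (vec.span {lift_vec (Wt x) (Zt x)}) (\<pi>t x)"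
    and \<xi>t: "\<forall>x\<in>\<Omega>. \<xi>t x = \<xi> x - (2 * s) *\<^sub>R off_diag (outer (Wh x) (Zh x) ** J_mat)"
    and Et: "\<forall>x\<in>\<Omega>. \<forall>\<mu>\<in>UNIV - {\<i> * of_real s, - \<i> * of_real s}.
           Et x \<mu> = E x \<mu> ** matrix_inv (q_map s (\<pi>t x) \<mu>)"
begin

abbreviation "c \<equiv> \<i> * complex_of_real s"

abbreviation "u x \<equiv> lift_vec (Wt x) (Zt x)"

lemma E_smooth: "smooth_on \<Omega> (\<lambda>x. E x \<mu>)"
  using frame by (simp add: G1_frame_def)

lemma E_props:
  assumes "x \<in> \<Omega>"
  shows "invertible (E x \<mu>)" "conj_mat (E x (cnj \<mu>)) = E x \<mu>"
    "I_m_n1 ** E x \<mu> ** I_m_n1 = E x (- \<mu>)" "transpose (E x \<mu>) ** I_nm_1 ** E x \<mu> = I_nm_1"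
  using frame assms by (simp_all add: G1_frame_def)

lemma E_deriv:
  assumes "x \<in> \<Omega>"
  shows "((\<lambda>y. E y \<mu>) has_derivative (\<lambda>v. E x \<mu> ** theta \<xi> \<mu> x v)) (at x)"
proof -
  have "matrix_inv (E x \<mu>) ** frechet_derivative (\<lambda>y. E y \<mu>) (at x) v = theta \<xi> \<mu> x v" for v
    using frame assms by (simp add: G1_frame_def)
  from arg_cong [OF this, of "\<lambda>M. E x \<mu> ** M"]
  have "frechet_derivative (\<lambda>y. E y \<mu>) (at x) = (\<lambda>v. E x \<mu> ** theta \<xi> \<mu> x v)"
    by (simp add: matrix_mul_assoc matrix_inv_mult [OF E_props(1) [OF assms]] fun_eq_iff)
  then show ?thesis
    using smooth_on_has_derivative [OF E_smooth assms, of \<mu>] by simp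
qed

lemma u_eq:
  assumes "x \<in> \<Omega>"
  shows "u x = (I_nm_1 ** transpose (E x (- c)) ** I_nm_1) *v lift_vec W Z"
proof -
  have "I_nm_1 ** transpose (E x (- c)) ** I_nm_1 ** E x (- c) = mat 1"
    using arg_cong [OF E_props(4) [OF assms, of "- c"], of "\<lambda>M. I_nm_1 ** M"]
    by (simp add: matrix_mul_assoc)
  from matrix_inv_unique(2) [OF this] show ?thesis
    using lift assms by simp
qed

lemma u_has_derivative:
  assumes "x \<in> \<Omega>"
  shows "(u has_derivative (\<lambda>v. (cscale c (lead v) - brk v (\<xi> x)) *v u x)) (at x)"
proof -
  define L where "L M = (I_nm_1 ** transpose M ** I_nm_1) *v lift_vec W Z" for M :: "('m, 'k) cblock"
  note prod = bounded_bilinear.bounded_linear_left [OF bounded_bilinear_matrix_mult]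
    bounded_bilinear.bounded_linear_right [OF bounded_bilinear_matrix_mult]
  have "bounded_linear L"
    unfolding L_def
    by (intro bounded_linear_compose [OF bounded_bilinear.bounded_linear_left
            [OF bounded_bilinear_matrix_vector_mult]]
        bounded_linear_compose [OF prod(1)] bounded_linear_compose [OF prod(2)] bounded_linear_transpose)
  from bounded_linear.has_derivative [OF this E_deriv [OF assms, of "- c"]]
  have "(u has_derivative (\<lambda>v. L (E x (- c) ** theta \<xi> (- c) x v))) (at x)"
    by (rule has_derivative_transform_within_open [OF _ open_dom assms]) (simp add: L_def u_eq)
  moreover have "L (E x (- c) ** theta \<xi> (- c) x v) = (cscale c (lead v) - brk v (\<xi> x)) *v u x" for v
  proof -
    define X where "X = theta \<xi> (- c) x v"
    have X: "X = - (cscale c (lead v) - brk v (\<xi> x))"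
      unfolding X_def theta_eq by (simp add: vec_eq_iff)
    have "transpose X = cscale (- c) (transpose (lead v)) + transpose (brk v (\<xi> x))"
      unfolding X_def theta_eq by (simp add: transpose_def vec_eq_iff)
    then have "transpose X ** I_nm_1 = - (I_nm_1 ** X)"
      unfolding X_def theta_eq
      by (simp add: matrix_expand lead_skew brk_skew) (simp add: vec_eq_iff)
    then have "I_nm_1 ** transpose X ** I_nm_1 = - X"
      by (simp add: matrix_mul_assoc [symmetric] matrix_minus_right)
        (simp add: matrix_mul_assoc)
    then have "I_nm_1 ** transpose X = - X ** I_nm_1"
      by (metis I_nm_1_square matrix_mul_assoc matrix_mul_rid)
    then have "I_nm_1 ** transpose (E x (- c) ** X) ** I_nm_1 =
        - X ** (I_nm_1 ** transpose (E x (- c)) ** I_nm_1)"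
      by (simp add: matrix_transpose_mul matrix_mul_assoc)
    then show ?thesis
      unfolding L_def X_def [symmetric] u_eq [OF assms]
      by (simp only: matrix_vector_mul_assoc X minus_minus)
  qed
  ultimately show ?thesis by simp
qed

lemma u_isotropic:
  assumes "x \<in> \<Omega>"
  shows "cdot (u x) (I_nm_1 *v u x) = 0"
proof -
  have "E x (- c) *v u x = lift_vec W Z"
    using lift assms matrix_inv_mult(2) [OF E_props(1) [OF assms]] by (simp add: matrix_vector_mul_assoc)
  then have "cdot (u x) (I_nm_1 *v u x) = cdot (lift_vec W Z) (I_nm_1 *v lift_vec W Z)"
    by (metis E_props(4) [OF assms] cdot_matrix_vector matrix_vector_mul_assoc)
  then show ?thesis
    by (simp add: cdot_lift_vec unit)
qed

lemma Zt_norm: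
  assumes "x \<in> \<Omega>"
  shows "Zt x \<bullet> (J_mat *v Zt x) = Wt x \<bullet> Wt x" "Wt x \<bullet> Wt x > 0"
proof -
  show "Zt x \<bullet> (J_mat *v Zt x) = Wt x \<bullet> Wt x"
    using u_isotropic [OF assms] by (simp add: cdot_lift_vec)
  show "Wt x \<bullet> Wt x > 0"
    using Wt_nonzero assms by simp
qed

lemma hat_eq:
  assumes "x \<in> \<Omega>"
  shows "Wh x = Wt x /\<^sub>R norm (Wt x)" "Zh x = Zt x /\<^sub>R norm (Wt x)"
  using hat assms Zt_norm(1) [OF assms] by (simp_all add: norm_n1_def norm_eq_sqrt_inner)

lemma hat_unit:
  assumes "x \<in> \<Omega>"
  shows "Wh x \<bullet> Wh x = 1" "Zh x \<bullet> (J_mat *v Zh x) = 1"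
proof -
  have "norm (Wt x) * norm (Wt x) = Wt x \<bullet> Wt x"
    by (simp add: norm_eq_sqrt_inner)
  moreover have "J_mat *v (r *\<^sub>R z) = r *\<^sub>R (J_mat *v z)" for r and z :: "'k rvec"
    by (simp add: matrix_vector_mult_def vec_eq_iff sum_distrib_left ac_simps)
  ultimately show "Wh x \<bullet> Wh x = 1" "Zh x \<bullet> (J_mat *v Zh x) = 1"
    using Zt_norm [OF assms] by (simp_all add: hat_eq [OF assms] divide_simps)
qed

lemma u_nonnull:
  assumes "x \<in> \<Omega>"
  shows "cdot (u x) (I_nm_1 *v conj_vec (u x)) \<noteq> 0"
proof -
  have "cdot (u x) (I_nm_1 *v conj_vec (u x)) = herm1 (u x) (u x)"
    unfolding herm1_cdot by (metis cdot_commute cdot_matrix_vector transpose_I_nm_1)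
  then show ?thesis
    using Zt_norm [OF assms] by (simp add: herm1_lift_vec del: of_real_add)
qed

lemma \<pi>t_eq:
  assumes "x \<in> \<Omega>"
  shows "\<pi>t x = line_proj I_nm_1 (u x)"
proof -
  have h: "herm1 (u x) v = cdot (I_nm_1 *v conj_vec (u x)) v" for v
    unfolding herm1_cdot by (metis cdot_matrix_vector transpose_I_nm_1)
  have "herm1 (u x) (u x) \<noteq> 0"
    using u_nonnull [OF assms] by (simp add: h cdot_commute)
  then have "\<pi>t x *v v = (herm1 (u x) v / herm1 (u x) (u x)) *s u x" for v
    using proj assms is_orth_proj1_span by blast
  moreover have "cscale k M *v v = k *s (M *v v)" for k v and M :: "('m, 'k) cblock"
    by (simp add: matrix_vector_mult_def vec_eq_iff sum_distrib_left mult.assoc)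
  ultimately show ?thesis
    unfolding matrix_eq line_proj_def
    by (simp add: tensor_mult_vec h cdot_commute [of "u x"] divide_inverse vec_eq_iff ac_simps)
qed

lemma \<pi>t_props:
  assumes "x \<in> \<Omega>"
  shows "\<pi>t x ** \<pi>t x = \<pi>t x" "conj_mat (\<pi>t x) ** \<pi>t x = 0"
    "transpose (\<pi>t x) ** I_nm_1 = I_nm_1 ** conj_mat (\<pi>t x)"
    "I_m_n1 ** \<pi>t x ** I_m_n1 = conj_mat (\<pi>t x)"
    "conj_mat (\<pi>t x) ** (lead v ** \<pi>t x) = 0"
  unfolding \<pi>t_eq [OF assms]
  by (rule line_proj_idem line_proj_isotropic line_proj_adjoint line_proj_parity line_proj_skew
      transpose_I_nm_1 conj_I_nm_1 u_nonnull [OF assms] u_isotropic [OF assms] transpose_I_m_n1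
      I_m_n1_square I_m_n1_commute conj_lift_vec [symmetric] lead_skew)+

lemma hat_blocks:
  assumes "x \<in> \<Omega>"
  shows "cmat (pot_real (outer (Wh x) (Zh x) ** J_mat)) = cscale \<i> (\<pi>t x - conj_mat (\<pi>t x))"
    and "\<pi>t x + conj_mat (\<pi>t x) = cmat (block (outer (Wh x) (Wh x)) 0 0 (outer (Zh x) (Zh x) ** J_mat))"
proof -
  define r where "r = complex_of_real (norm (Wt x))"
  have r: "r \<noteq> 0"
    using Wt_nonzero assms by (simp add: r_def)
  have "lift_vec (Wh x) (Zh x) $ i = (inverse r *s u x) $ i" for i
    by (cases i) (simp_all add: lift_vec_def hat_eq [OF assms] r_def)
  then have eq: "lift_vec (Wh x) (Zh x) = inverse r *s u x"
    by (simp add: vec_eq_iff)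
  have "vec.span {lift_vec (Wh x) (Zh x)} = vec.span {u x}"
    using vec.span_image_scale [of "{u x}" "\<lambda>_. inverse r"] r by (simp add: eq)
  then have "is_orth_proj1 (vec.span {lift_vec (Wh x) (Zh x)}) (\<pi>t x)"
    using proj assms by simp
  from orth_proj1_blocks [OF hat_unit [OF assms] this]
  show "cmat (pot_real (outer (Wh x) (Zh x) ** J_mat)) = cscale \<i> (\<pi>t x - conj_mat (\<pi>t x))"
    and "\<pi>t x + conj_mat (\<pi>t x) = cmat (block (outer (Wh x) (Wh x)) 0 0 (outer (Zh x) (Zh x) ** J_mat))" .
qed

lemma brk_\<xi>t:
  assumes "x \<in> \<Omega>"
  shows "brk v (\<xi>t x) = brk v (\<xi> x) -
    cscale (2 * c) (lead v ** (\<pi>t x - conj_mat (\<pi>t x)) - (\<pi>t x - conj_mat (\<pi>t x)) ** lead v)"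
proof -
  have "brk v (\<xi>t x) = brk v (\<xi> x) - (2 * s) *\<^sub>R brk v (outer (Wh x) (Zh x) ** J_mat)"
    using \<xi>t assms by (simp add: linear_diff [OF linear_brk] linear_scale [OF linear_brk] brk_off_diag)
  then show ?thesis
    unfolding brk_def [of v "outer _ _ ** _"] hat_blocks(1) [OF assms] cscale_mult_left cscale_mult_right
    by (simp add: vec_eq_iff) (simp add: scaleR_conv_of_real algebra_simps)
qed

lemma u_smooth: "smooth_on \<Omega> u"
proof -
  note prod = bounded_bilinear.bounded_linear_left [OF bounded_bilinear_matrix_mult]
    bounded_bilinear.bounded_linear_right [OF bounded_bilinear_matrix_mult]
  have "smooth_on \<Omega> (\<lambda>x. (I_nm_1 ** transpose (E x (- c)) ** I_nm_1) *v lift_vec W Z)"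
    by (intro smooth_on_linear [OF bounded_bilinear.bounded_linear_left
            [OF bounded_bilinear_matrix_vector_mult]]
        smooth_on_linear [OF prod(1)] smooth_on_linear [OF prod(2)]
        smooth_on_linear [OF bounded_linear_transpose] open_dom E_smooth)
  then show ?thesis
    using smooth_on_cong [OF open_dom u_eq] by simp
qed

lemma \<pi>t_smooth: "smooth_on \<Omega> \<pi>t"
proof -
  define K where "K x = tensor (u x) (I_nm_1 *v conj_vec (u x))" for x
  have K: "smooth_on \<Omega> K"
    unfolding K_def
    by (intro smooth_on_bilinear [OF bounded_bilinear_tensor] open_dom u_smooth
        smooth_on_linear [OF bounded_bilinear.bounded_linear_right
            [OF bounded_bilinear_matrix_vector_mult]]
        smooth_on_linear [OF bounded_linear_conj_vec])
  have "smooth_on \<Omega> (\<lambda>x. cscale (inverse (trace (K x))) (K x))"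
    using u_nonnull
    by (intro smooth_on_bilinear [OF bounded_bilinear_cscale] smooth_on_inverse open_dom K
        smooth_on_linear [OF bounded_linear_trace]) (simp add: K_def trace_tensor)
  then show ?thesis
    using smooth_on_cong [OF open_dom, of \<pi>t "\<lambda>x. cscale (inverse (trace (K x))) (K x)"]
    by (simp add: \<pi>t_eq line_proj_def K_def trace_tensor)
qed

lemma \<pi>t_has_derivative:
  assumes "x \<in> \<Omega>"
  shows "(\<pi>t has_derivative (\<lambda>v. \<pi>t x ** brk v (\<xi> x) - brk v (\<xi> x) ** \<pi>t x + cscale c
       (\<pi>t x ** lead v + lead v ** \<pi>t x - cscale 2 (\<pi>t x ** (lead v ** \<pi>t x))))) (at x)"
  unfolding \<pi>t_eq [OF assms]
  by (rule has_derivative_transform_within_open [OF line_proj_has_derivative open_dom assms])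
    (rule transpose_I_nm_1 conj_I_nm_1 u_nonnull [OF assms] conj_lead conj_brk lead_skew brk_skew
      u_has_derivative [OF assms] \<pi>t_eq [symmetric] | assumption)+

lemma Et_eq:
  assumes "x \<in> \<Omega>" "\<mu> \<noteq> c" "\<mu> \<noteq> - c"
  shows "Et x \<mu> = E x \<mu> ** gauge s (\<pi>t x) \<mu>"
  using Et assms matrix_inv_q_map [OF \<pi>t_props(1,2) [OF assms(1)] assms(2,3)] by simp

lemma gauge_has_derivative:
  assumes "x \<in> \<Omega>" "\<mu> \<noteq> c" "\<mu> \<noteq> - c"
  shows "((\<lambda>y. gauge s (\<pi>t y) \<mu>) has_derivative
    (\<lambda>v. gauge s (\<pi>t x) \<mu> ** theta \<xi>t \<mu> x v - theta \<xi> \<mu> x v ** gauge s (\<pi>t x) \<mu>)) (at x)"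
proof -
  define P where "P = \<pi>t x"
  define P' where "P' v = P ** brk v (\<xi> x) - brk v (\<xi> x) ** P + cscale c
       (P ** lead v + lead v ** P - cscale 2 (P ** (lead v ** P)))" for v
  define e where "e = - 2 * c / (\<mu> + c)"
  define f where "f = 2 * c / (\<mu> - c)"
  have dP: "(\<pi>t has_derivative P') (at x)"
    using \<pi>t_has_derivative [OF assms(1)] unfolding P'_def P_def .
  have lin: "bounded_linear (cscale k :: ('m, 'k) cblock \<Rightarrow> ('m, 'k) cblock)" for k
    by (rule bounded_bilinear.bounded_linear_right [OF bounded_bilinear_cscale])
  have "((\<lambda>y. mat 1 + cscale e (\<pi>t y) + cscale f (conj_mat (\<pi>t y))) has_derivative
      (\<lambda>v. 0 + cscale e (P' v) + cscale f (conj_mat (P' v)))) (at x)"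
    by (intro has_derivative_add has_derivative_const bounded_linear.has_derivative [OF lin]
        bounded_linear.has_derivative [OF bounded_linear_conj_mat] dP)
  moreover have "cscale e (P' v) + cscale f (conj_mat (P' v)) =
      gauge s (\<pi>t x) \<mu> ** theta \<xi>t \<mu> x v - theta \<xi> \<mu> x v ** gauge s (\<pi>t x) \<mu>" for v
  proof -
    note props = \<pi>t_props [OF assms(1), folded P_def]
    have cP: "conj_mat P ** conj_mat P = conj_mat P" "P ** conj_mat P = 0" "P ** (lead v ** conj_mat P) = 0"
      using arg_cong [OF props(1), of conj_mat] arg_cong [OF props(2), of conj_mat]
        arg_cong [OF props(5) [of v], of conj_mat]
      by (simp_all add: conj_mat_mult conj_lead) (simp_all add: vec_eq_iff)
    have "conj_mat (P' v) = conj_mat P ** brk v (\<xi> x) - brk v (\<xi> x) ** conj_mat P - cscale c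
        (conj_mat P ** lead v + lead v ** conj_mat P - cscale 2 (conj_mat P ** (lead v ** conj_mat P)))"
      unfolding P'_def
      by (simp add: conj_mat_add conj_mat_diff conj_mat_cscale conj_mat_mult conj_lead conj_brk)
        (simp add: vec_eq_iff)
    from dressing_identity [OF assms(2,3) props(1) cP(1) props(5) cP(3)
        brk_\<xi>t [OF assms(1), folded P_def] P'_def this cP(2) props(2)]
    show ?thesis
      unfolding e_def f_def gauge_def theta_eq P_def [symmetric] .
  qed
  ultimately show ?thesis
    unfolding gauge_def e_def f_def by simp
qed

lemma Et_smooth:
  assumes "\<mu> \<noteq> c" "\<mu> \<noteq> - c"
  shows "smooth_on \<Omega> (\<lambda>x. Et x \<mu>)"
proof -
  have lin: "bounded_linear (cscale k :: ('m, 'k) cblock \<Rightarrow> ('m, 'k) cblock)" for k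
    by (rule bounded_bilinear.bounded_linear_right [OF bounded_bilinear_cscale])
  have "smooth_on \<Omega> (\<lambda>x. E x \<mu> ** gauge s (\<pi>t x) \<mu>)"
    unfolding gauge_def
    by (intro smooth_on_bilinear [OF bounded_bilinear_matrix_mult] smooth_on_add smooth_on_const
        smooth_on_linear [OF lin] smooth_on_linear [OF bounded_linear_conj_mat] open_dom
        E_smooth \<pi>t_smooth)
  then show ?thesis
    using smooth_on_cong [OF open_dom, of "\<lambda>x. Et x \<mu>"] Et_eq assms by simp
qed

lemma Et_orthogonal:
  assumes "x \<in> \<Omega>" "\<mu> \<noteq> c" "\<mu> \<noteq> - c"
  shows "transpose (Et x \<mu>) ** I_nm_1 ** Et x \<mu> = I_nm_1"
proof -
  have "transpose (Et x \<mu>) ** I_nm_1 ** Et x \<mu> = transpose (gauge s (\<pi>t x) \<mu>) **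
      (transpose (E x \<mu>) ** I_nm_1 ** E x \<mu>) ** gauge s (\<pi>t x) \<mu>"
    unfolding Et_eq [OF assms] by (simp add: matrix_transpose_mul matrix_mul_assoc)
  then show ?thesis
    using gauge_orthogonal [OF \<pi>t_props(1,2) [OF assms(1)] assms(2,3) \<pi>t_props(3) [OF assms(1)]]
    by (simp add: E_props(4) [OF assms(1)])
qed

lemma Et_invertible:
  assumes "x \<in> \<Omega>" "\<mu> \<noteq> c" "\<mu> \<noteq> - c"
  shows "invertible (Et x \<mu>)"
proof -
  have "I_nm_1 ** transpose (Et x \<mu>) ** I_nm_1 ** Et x \<mu> = mat 1"
    using arg_cong [OF Et_orthogonal [OF assms], of "\<lambda>M. I_nm_1 ** M"]
    by (simp add: matrix_mul_assoc)
  then show ?thesis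
    using invertible_left_inverse by blast
qed

lemma Et_derivative:
  assumes "x \<in> \<Omega>" "\<mu> \<noteq> c" "\<mu> \<noteq> - c"
  shows "frechet_derivative (\<lambda>y. Et y \<mu>) (at x) v = Et x \<mu> ** theta \<xi>t \<mu> x v"
proof -
  let ?G = "gauge s (\<pi>t x) \<mu>"
  have "((\<lambda>y. E y \<mu> ** gauge s (\<pi>t y) \<mu>) has_derivative (\<lambda>v. E x \<mu> **
      (?G ** theta \<xi>t \<mu> x v - theta \<xi> \<mu> x v ** ?G) + E x \<mu> ** theta \<xi> \<mu> x v ** ?G)) (at x)"
    by (intro bounded_bilinear.FDERIV [OF bounded_bilinear_matrix_mult] E_deriv
        gauge_has_derivative assms)
  then have "((\<lambda>y. Et y \<mu>) has_derivative (\<lambda>v. E x \<mu> **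
      (?G ** theta \<xi>t \<mu> x v - theta \<xi> \<mu> x v ** ?G) + E x \<mu> ** theta \<xi> \<mu> x v ** ?G)) (at x)"
    by (rule has_derivative_transform_within_open [OF _ open_dom assms(1)])
      (simp add: Et_eq assms)
  from fun_cong [OF frechet_derivative_at [OF this, symmetric], of v] show ?thesis
    by (simp add: Et_eq [OF assms] matrix_expand)
qed

lemma Et_holomorphic:
  assumes "x \<in> \<Omega>"
  shows "(\<lambda>\<mu>. Et x \<mu> $ i $ j) holomorphic_on (UNIV - {c, - c})"
proof -
  have E: "(\<lambda>\<mu>. E x \<mu> $ i $ j) holomorphic_on (UNIV - {c, - c})" for i j
  proof -
    have "(\<lambda>\<mu>. E x \<mu> $ i $ j) holomorphic_on UNIV"
      using frame assms by (simp add: G1_frame_def)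
    then show ?thesis
      by (rule holomorphic_on_subset) simp
  qed
  have "(\<lambda>\<mu>. \<Sum>k\<in>UNIV. E x \<mu> $ i $ k * gauge s (\<pi>t x) \<mu> $ k $ j) holomorphic_on (UNIV - {c, - c})"
    by (auto simp: gauge_def eq_neg_iff_add_eq_0 intro!: holomorphic_intros E)
  moreover have "(\<Sum>k\<in>UNIV. E x \<mu> $ i $ k * gauge s (\<pi>t x) \<mu> $ k $ j) = Et x \<mu> $ i $ j"
    if "\<mu> \<in> UNIV - {c, - c}" for \<mu>
    using that assms by (simp add: Et_eq matrix_matrix_mult_def)
  ultimately show ?thesis
    by (rule holomorphic_transform)
qed

lemma new_frame: "G1_frame \<Omega> (UNIV - {c, - c}) \<xi>t Et"
  unfolding G1_frame_def
proof (intro conjI ballI allI)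
  fix x \<mu> v assume x: "x \<in> \<Omega>" and "\<mu> \<in> UNIV - {c, - c}"
  then have \<mu>: "\<mu> \<noteq> c" "\<mu> \<noteq> - c" by auto
  show "invertible (Et x \<mu>)"
    by (rule Et_invertible [OF x \<mu>])
  then show "matrix_inv (Et x \<mu>) ** frechet_derivative (\<lambda>y. Et y \<mu>) (at x) v = theta \<xi>t \<mu> x v"
    by (simp add: Et_derivative [OF x \<mu>] matrix_mul_assoc matrix_inv_mult)
  have "cnj \<mu> \<noteq> c" "cnj \<mu> \<noteq> - c"
    using \<mu> by (auto simp: complex_eq_iff)
  then show "conj_mat (Et x (cnj \<mu>)) = Et x \<mu>"
    using E_props(2) [OF x] by (simp add: Et_eq x \<mu> conj_mat_mult conj_gauge)
  have \<mu>': "- \<mu> \<noteq> c" "- \<mu> \<noteq> - c"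
    using \<mu> by (metis minus_minus)+
  have "I_m_n1 ** Et x \<mu> ** I_m_n1 = (I_m_n1 ** E x \<mu> ** I_m_n1) ** (I_m_n1 ** gauge s (\<pi>t x) \<mu> ** I_m_n1)"
    by (simp add: Et_eq [OF x \<mu>] matrix_mul_assoc [symmetric] I_m_n1_cancel)
  also have "\<dots> = Et x (- \<mu>)"
    by (simp only: Et_eq [OF x \<mu>'] E_props(3) [OF x] parity_gauge [OF I_m_n1_square \<pi>t_props(4) [OF x]])
  finally show "I_m_n1 ** Et x \<mu> ** I_m_n1 = Et x (- \<mu>)" .
  show "transpose (Et x \<mu>) ** I_nm_1 ** Et x \<mu> = I_nm_1"
    by (rule Et_orthogonal [OF x \<mu>])
qed (use Et_smooth Et_holomorphic in auto)

lemma \<xi>t_smooth: "smooth_on \<Omega> \<xi>t"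
proof -
  define L where "L M = (4 * s) *\<^sub>R off_diag (\<chi> a b. Im (M $ Inl a $ Inr b))"
    for M :: "('m, 'k) cblock"
  have "bounded_linear L"
    unfolding linear_conv_bounded_linear [symmetric] L_def
    by (auto intro!: linearI simp: off_diag_def vec_eq_iff algebra_simps)
  from smooth_on_linear [OF this open_dom \<pi>t_smooth]
  have sm: "smooth_on \<Omega> (\<lambda>x. \<xi> x + L (\<pi>t x))"
    using solution by (intro smooth_on_add open_dom) (auto simp: G1_solution_def)
  have "\<xi>t x = \<xi> x + L (\<pi>t x)" if x: "x \<in> \<Omega>" for x
  proof -
    have "(outer (Wh x) (Zh x) ** J_mat) $ a $ b = - 2 * Im (\<pi>t x $ Inl a $ Inr b)" for a b
    proof -
      have "complex_of_real ((outer (Wh x) (Zh x) ** J_mat) $ a $ b) =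
          \<i> * (\<pi>t x $ Inl a $ Inr b - cnj (\<pi>t x $ Inl a $ Inr b))"
        using arg_cong [OF hat_blocks(1) [OF x], of "\<lambda>M. M $ Inl a $ Inr b"] by (simp add: pot_real_def)
      from arg_cong [OF this, of Re] show ?thesis by simp
    qed
    then show ?thesis
      using \<xi>t x by (simp add: L_def off_diag_def vec_eq_iff)
  qed
  then show ?thesis
    using smooth_on_cong [OF open_dom, of \<xi>t "\<lambda>x. \<xi> x + L (\<pi>t x)"] sm by simp
qed

lemma new_solution: "G1_solution \<Omega> \<xi>t"
proof -
  have diff: "(\<lambda>y. theta \<xi>t \<mu> y v) differentiable at x" if "x \<in> \<Omega>" for \<mu> v x
  proof -
    have "bounded_linear (brk v :: _ \<Rightarrow> ('m, 'k) cblock)"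
      using linear_brk linear_conv_bounded_linear by blast
    from bounded_linear.has_derivative [OF this smooth_on_has_derivative [OF \<xi>t_smooth that]]
    show ?thesis
      unfolding theta_eq differentiable_def using has_derivative_add [OF has_derivative_const] by fastforce
  qed
  have regular: "flat_on \<Omega> (theta \<xi>t \<mu>)" if \<mu>: "\<mu> \<noteq> c" "\<mu> \<noteq> - c" for \<mu>
    by (rule flat_on_frame [OF open_dom Et_smooth [OF \<mu>] Et_invertible [OF _ \<mu>] Et_derivative [OF _ \<mu>] diff])
  have "c \<noteq> 0"
    using s by simp
  then have "flat_on \<Omega> (theta \<xi>t \<mu>)" for \<mu>
    using flat_on_theta [OF open_dom \<xi>t_smooth _ regular] by blast
  moreover have "\<xi>t x $ a $ b = 0" if "x \<in> \<Omega>" "pos a = pos b" for x a b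
    using solution \<xi>t that by (simp add: G1_solution_def off_diag_def)
  ultimately show ?thesis
    using \<xi>t_smooth by (simp add: G1_solution_def)
qed

lemma frames_at_0:
  assumes "x \<in> \<Omega>"
  defines "A \<equiv> \<chi> a b. Re (E x 0 $ Inl a $ Inl b)" and "B \<equiv> \<chi> a b. Re (E x 0 $ Inr a $ Inr b)"
  shows "E x 0 = cmat (block A 0 0 B)"
    and "Et x 0 = cmat (block (A ** (mat 1 - 2 *\<^sub>R outer (Wh x) (Wh x))) 0
      0 (B ** (mat 1 - 2 *\<^sub>R (outer (Zh x) (Zh x) ** J_mat))))"
proof -
  have real: "cnj (E x 0 $ i $ j) = E x 0 $ i $ j" for i j
    using arg_cong [OF E_props(2) [OF assms(1), of 0], of "\<lambda>M. M $ i $ j"] by simp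
  have cz: "z = 0" if "z = - z" for z :: complex
    using that by simp
  have par: "I_m_n1 ** M ** I_m_n1 = block (\<chi> a b. M $ Inl a $ Inl b) (\<chi> a d. - M $ Inl a $ Inr d)
      (\<chi> c b. - M $ Inr c $ Inl b) (\<chi> c d. M $ Inr c $ Inr d)" for M :: "('m, 'k) cblock"
  proof -
    have M: "M = block (\<chi> a b. M $ Inl a $ Inl b) (\<chi> a d. M $ Inl a $ Inr d)
      (\<chi> c b. M $ Inr c $ Inl b) (\<chi> c d. M $ Inr c $ Inr d)"
      by (simp add: block_eq_iff)
    show ?thesis
      by (subst M) (simp add: I_m_n1_def block_mult matrix_minus_left matrix_minus_right block_eq_iff)
  qed
  have off: "E x 0 $ Inl a $ Inr d = 0" "E x 0 $ Inr d $ Inl a = 0" for a d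
    using E_props(3) [OF assms(1), of 0] unfolding par by (auto simp: block_eq_iff)
  have Re: "complex_of_real (Re z) = z" if "cnj z = z" for z
    using that by (simp add: complex_eq_iff)
  show E0: "E x 0 = cmat (block A 0 0 B)"
    unfolding block_eq_iff A_def B_def by (simp add: off Re real)
  have "gauge s (\<pi>t x) 0 = mat 1 - cscale 2 (\<pi>t x + conj_mat (\<pi>t x))"
    using s by (simp add: gauge_def vec_eq_iff algebra_simps)
  also have "\<dots> = cmat (block (mat 1 - 2 *\<^sub>R outer (Wh x) (Wh x)) 0
      0 (mat 1 - 2 *\<^sub>R (outer (Zh x) (Zh x) ** J_mat)))"
    unfolding hat_blocks(2) [OF assms(1)] mat_1_block by (simp add: block_eq_iff mat_def)
  finally show "Et x 0 = cmat (block (A ** (mat 1 - 2 *\<^sub>R outer (Wh x) (Wh x))) 0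
      0 (B ** (mat 1 - 2 *\<^sub>R (outer (Zh x) (Zh x) ** J_mat))))"
    using s by (simp add: Et_eq [OF assms(1)] E0 cmat_mult [symmetric] block_mult)
qed

end

theorem theorem11p1:
  fixes m n :: nat
    and \<Omega> :: "'k::{finite,linorder} rvec set"
    and \<xi> \<xi>t :: "'k rvec \<Rightarrow> ('m::{finite,linorder}, 'k) rmat"
    and E Et :: "'k rvec \<Rightarrow> complex \<Rightarrow> ('m, 'k) cblock"
    and s :: real
    and W :: "'m rvec" and Z :: "'k rvec"
    and Wt Wh :: "'k rvec \<Rightarrow> 'm rvec" and Zt Zh :: "'k rvec \<Rightarrow> 'k rvec"
    and \<pi>t :: "'k rvec \<Rightarrow> ('m, 'k) cblock"
  assumes "CARD('m) = m" and "CARD('k) = n + 1" and "m \<ge> n + 1"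
    and "open \<Omega>"
    and "G1_solution \<Omega> \<xi>"
    and "G1_frame \<Omega> UNIV \<xi> E"
    and "s \<noteq> 0"
    and "W \<bullet> W = 1" and "Z \<bullet> (J_mat *v Z) = 1"
    and "\<forall>x\<in>\<Omega>. lift_vec (Wt x) (Zt x) = matrix_inv (E x (- \<i> * of_real s)) *v lift_vec W Z"
    and "\<forall>x\<in>\<Omega>. Wt x \<noteq> 0"
    and "\<forall>x\<in>\<Omega>. Wh x = Wt x /\<^sub>R norm (Wt x) \<and> Zh x = Zt x /\<^sub>R norm_n1 (Zt x)"
    and "\<forall>x\<in>\<Omega>. is_orth_proj1 (vec.span {lift_vec (Wt x) (Zt x)}) (\<pi>t x)"
    and "\<forall>x\<in>\<Omega>. \<xi>t x = \<xi> x -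
           (2 * s) *\<^sub>R off_diag (outer (Wh x) (Zh x) ** J_mat)"
    and "\<forall>x\<in>\<Omega>. \<forall>\<mu>\<in>UNIV - {\<i> * of_real s, - \<i> * of_real s}.
           Et x \<mu> = E x \<mu> ** matrix_inv (q_map s (\<pi>t x) \<mu>)"
  shows "G1_solution \<Omega> \<xi>t
    \<and> G1_frame \<Omega> (UNIV - {\<i> * of_real s, - \<i> * of_real s}) \<xi>t Et
    \<and> (\<exists>(A :: 'k rvec \<Rightarrow> ('m, 'm) rmat) (At :: 'k rvec \<Rightarrow> ('m, 'm) rmat)
          (B :: 'k rvec \<Rightarrow> ('k, 'k) rmat) (Bt :: 'k rvec \<Rightarrow> ('k, 'k) rmat). \<forall>x\<in>\<Omega>.
         E x 0 = cmat (block (A x) 0 0 (B x)) \<and>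
         Et x 0 = cmat (block (At x) 0 0 (Bt x)) \<and>
         At x = A x ** (mat 1 - 2 *\<^sub>R outer (Wh x) (Wh x)) \<and>
         Bt x = B x ** (mat 1 - 2 *\<^sub>R (outer (Zh x) (Zh x) ** J_mat)))"
proof -
  interpret simple_dressing \<Omega> \<xi> \<xi>t E Et s W Z Wt Wh Zt Zh \<pi>t
    by unfold_locales (fact assms)+
  show ?thesis
    using new_solution new_frame frames_at_0
    by (intro conjI exI [of _ "\<lambda>x. \<chi> a b. Re (E x 0 $ Inl a $ Inl b)"]
        exI [of _ "\<lambda>x. (\<chi> a b. Re (E x 0 $ Inl a $ Inl b)) ** (mat 1 - 2 *\<^sub>R outer (Wh x) (Wh x))"]
        exI [of _ "\<lambda>x. \<chi> a b. Re (E x 0 $ Inr a $ Inr b)"]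
        exI [of _ "\<lambda>x. (\<chi> a b. Re (E x 0 $ Inr a $ Inr b)) ** (mat 1 - 2 *\<^sub>R (outer (Zh x) (Zh x) ** J_mat))"])
      auto
qed

end
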